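(* Let $a<b$ be real numbers, let $k\ge 1$ and $m\ge 0$ be integers, and let $u_1,\dots,u_{m+k}\in\mathbb{R}^m$ be such that (if $m>0$) $u_1,\dots,u_m$ are linearly independent, i.e. $$\mathcal{V}_0:=\begin{vmatrix} u_{1,1}&\cdots&u_{1,m}\\ \vdots&\ddots&\vdots\\ u_{m,1}&\cdots&u_{m,m}\end{vmatrix}\neq 0 .$$ Let $w_1,\dots,w_{m+k}\in D^k([a,b])$ be functions satisfying $$\mathcal{V}_n(\xi):=\mathcal{W}\begin{pmatrix} w_1,&\dots,&w_{m+n}\\ u_1,&\dots,&u_{m+n}\end{pmatrix}(\underbrace{\xi,\dots,\xi}_{n\text{ times}})\neq 0\qquad\text{for all }\xi\in[a,b]\text{ and } n=1,\dots,k.$$ Then, for all nonidentical points $x_1,\dots,x_{k+1}\in[a,b]$ (i.e. $\min_i x_i<\max_i x_i$), all vectors $p,q\in\mathbb{R}^m$ and all functions $f,g\in D^k([a,b])$, there exists a point $\xi$ with $\min_i x_i<\xi<\max_i x_i$ such that $$\mathcal{W}\begin{pmatrix} w_1,&\dots,&w_{m+k},&f\\ u_1,&\dots,&u_{m+k},&p\end{pmatrix}(\underbrace{\xi,\dots,\xi}_{k+1\text{ times}})\cdot \mathcal{W}\begin{pmatrix} w_1,&\dots,&w_{m+k},&g\\ u_1,&\dots,&u_{m+k},&q\end{pmatrix}(x_1,\dots,x_{k+1})$$ $$=\mathcal{W}\begin{pmatrix} w_1,&\dots,&w_{m+k},&g\\ u_1,&\dots,&u_{m+k},&q\end{pmatrix}(\underbrace{\xi,\dots,\xi}_{k+1\text{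 times}})\cdot \mathcal{W}\begin{pmatrix} w_1,&\dots,&w_{m+k},&f\\ u_1,&\dots,&u_{m+k},&p\end{pmatrix}(x_1,\dots,x_{k+1}).$$
   Context: $D^k([a,b])$ denotes the class of functions $f:[a,b]\to\mathbb{R}$ that are $k-1$ times continuously differentiable on $[a,b]$ (one-sided derivatives at the endpoints) and $k$ times differentiable on the open interval $]a,b[$. For a vector $u_i\in\mathbb{R}^m$, $u_{i,j}$ denotes its $j$th coordinate. Given points $x_1,\dots,x_\ell\in[a,b]$, let $\xi_1<\cdots<\xi_n$ be the distinct values among them and let $k_1,\dots,k_n\ge1$ be their multiplicities, so $k_1+\cdots+k_n=\ell$ and a rearrangement of $(x_1,\dots,x_\ell)$ equals $(\xi_1,\dots,\xi_1,\dots,\xi_n,\dots,\xi_n)$ with $\xi_j$ repeated $k_j$ times. For functions $\omega_1,\dots,\omega_{m+\ell}:[a,b]\to\mathbb{R}$ (for which the derivatives appearing below exist) and vectors $v_1,\dots,v_{m+\ell}\in\mathbb{R}^m$, $$\mathcal{W}\begin{pmatrix}\omega_1,&\dots,&\omega_{m+\ell}\\ v_1,&\dots,&v_{m+\ell}\end{pmatrix}(x_1,\dots,x_\ell)$$ denotes the $(m+\ell)\times(m+\ell)$ determinant whose $i$th row is $$\bigl(v_{i,1},\dots,v_{i,m},\ \omega_i(\xi_1),\omega_i'(\xi_1),\dots,\omega_i^{(k_1-1)}(\xi_1),\ \dots,\ \omega_i(\xi_n),\omega_i'(\xi_n),\dots,\omega_i^{(k_n-1)}(\xi_n)\bigr),\quad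 i=1,\dots,m+\ell.$$ For $m=0$ the convention is $\mathbb{R}^0=\{0\}$, and the determinant is the $\ell\times\ell$ determinant with no vector columns (its value does not involve the $v_i$); the hypothesis on $\mathcal{V}_0$ is then void. *)

theory Defs
  imports "HOL-Analysis.Derivative" "Jordan_Normal_Form.Determinant"
begin

(* All derivatives are taken within S. For S = {a..b} with a < b these are the one-sided
   derivatives at a and b and the ordinary derivatives at interior points, and on S they
   depend only on the values of f on S. *)
definition nth_deriv_within :: "real set \<Rightarrow> nat \<Rightarrow> (real \<Rightarrow> real) \<Rightarrow> real \<Rightarrow> real" where
  "nth_deriv_within S j f = ((\<lambda>g x. vector_derivative g (at x within S)) ^^ j) f"

(* Meaningful for k \<ge> 1 only. Functions on [a,b] are represented by total functions whose
   values outside [a,b] are irrelevant. For j < k - 1 the continuity of the j-th derivative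
   on [a,b] follows from its differentiability. *)
definition D_class :: "nat \<Rightarrow> real \<Rightarrow> real \<Rightarrow> (real \<Rightarrow> real) set" where
  "D_class k a b =
    {f. (\<forall>j < k - 1. nth_deriv_within {a..b} j f differentiable_on {a..b}) \<and>
        continuous_on {a..b} (nth_deriv_within {a..b} (k - 1) f) \<and>
        nth_deriv_within {a..b} (k - 1) f differentiable_on {a<..<b}}"

(* The pairs (\<xi>\<^sub>1,0), ..., (\<xi>\<^sub>1,k\<^sub>1-1), ..., (\<xi>\<^sub>n,0), ..., (\<xi>\<^sub>n,k\<^sub>n-1), where
   \<xi>\<^sub>1 < ... < \<xi>\<^sub>n are the distinct entries of xs and k\<^sub>1, ..., k\<^sub>n their multiplicities. *)
definition confluent_nodes :: "real list \<Rightarrow> (real \<times> nat) list" where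
  "confluent_nodes xs =
    concat (map (\<lambda>\<xi>. map (\<lambda>d. (\<xi>, d)) [0..<count_list xs \<xi>]) (sorted_list_of_set (set xs)))"

(* Intended for lists \<omega>s and vs of length m + length xs and vectors of dimension m. *)
definition W_det ::
  "real set \<Rightarrow> nat \<Rightarrow> (real \<Rightarrow> real) list \<Rightarrow> real Matrix.vec list \<Rightarrow> real list \<Rightarrow> real" where
  "W_det S m \<omega>s vs xs =
    Determinant.det (Matrix.mat (m + length xs) (m + length xs) (\<lambda>(i, j).
      if j < m then vec_index (vs ! i) j
      else (case confluent_nodes xs ! (j - m) of (\<xi>, d) \<Rightarrow> nth_deriv_within S d (\<omega>s ! i) \<xi>)))"

lemma length_confluent_nodes: "length (confluent_nodes xs) = length xs"
  by (simp add: confluent_nodes_def length_concat comp_def sum_list_distinct_conv_sum_set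
      sum_count_set)

end

theory Submission
  imports Defs
begin

text \<open>
  Both determinants are linear in their last row, that is, in the pair \<open>(f, p)\<close>. With
  \<open>A = W(g, q)(xs)\<close> and \<open>B = W(f, p)(xs)\<close>, the pair \<open>(h, r) = A (f, p) - B (g, q)\<close> satisfies
  \<open>W(h, r)(xs) = 0\<close>, and the claim becomes the existence of an interior \<open>\<xi>\<close> with
  \<open>W(h, r)(\<xi>, \<dots>, \<xi>) = 0\<close>: a Rolle theorem for determinants (\<open>W_det_rolle\<close>).
  
  A determinant vanishes iff some nontrivial combination of its rows does. Since the first \<open>m\<close>
  vectors form a basis, the vector columns can be cleared by replacing each later function \<open>\<omega>\<^sub>m\<^sub>+\<^sub>i\<close>
  by \<open>\<omega>\<^sub>m\<^sub>+\<^sub>i - (\<Sum>t<m. \<alpha>\<^sub>i\<^sub>t \<omega>\<^sub>t)\<close>; then \<open>W = 0\<close> says that some nontrivial combination of these reduced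
  functions vanishes at the nodes with their multiplicities (\<open>W_det_eq_0_iff_reduced\<close>). In these
  terms the hypothesis says that no nontrivial combination of the first \<open>n\<close> reduced functions
  \<open>w\<^sub>0, \<dots>, w\<^sub>n\<^sub>-\<^sub>1\<close> vanishes to order \<open>n\<close> at any point, for \<open>n \<le> k\<close> (\<open>nondegenerate\<close>).
  
  The rest is reduction of order. In a nondegenerate family \<open>w\<^sub>0\<close> has no zero, and passing from
  \<open>w\<^sub>0, \<dots>, w\<^sub>k\<close> to \<open>(w\<^sub>1/w\<^sub>0)', \<dots>, (w\<^sub>k/w\<^sub>0)'\<close> preserves nondegeneracy and lowers \<open>k\<close> by one, while
  Rolle's theorem with multiplicities turns \<open>N\<close> zeros of \<open>f\<close> into \<open>N - 1\<close> zeros of \<open>(f/w\<^sub>0)'\<close>.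
  Induction on \<open>k\<close> gives two facts: a nontrivial combination of \<open>w\<^sub>0, \<dots>, w\<^sub>k\<^sub>-\<^sub>1\<close> has fewer than \<open>k\<close>
  zeros (\<open>chebyshev_system\<close>), and if \<open>f\<close> has \<open>k + 1\<close> zeros that are not all at one point, then
  some \<open>f - (\<Sum>i<k. e\<^sub>i w\<^sub>i)\<close> vanishes to order \<open>k + 1\<close> at a point strictly between the extreme
  zeros (\<open>osculating_combination\<close>). When \<open>W(h, r)(xs) = 0\<close>, the vanishing combination \<open>\<phi>\<close> of
  \<open>w\<^sub>0, \<dots>, w\<^sub>k\<^sub>-\<^sub>1\<close> and the reduction of \<open>h\<close> must involve the latter, by the first fact; applying
  the second fact to \<open>\<phi>\<close> gives a combination that is still nontrivial and vanishes to order
  \<open>k + 1\<close> at some \<open>\<xi>\<close>, so \<open>W(h, r)(\<xi>, \<dots>, \<xi>) = 0\<close>.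
\<close>

section \<open>Linear algebra of the determinants\<close>

lemma det_eq_0_iff_row_combination:
  fixes g :: "nat \<Rightarrow> nat \<Rightarrow> real"
  shows "Determinant.det (Matrix.mat N N (\<lambda>(i, j). g i j)) = 0 \<longleftrightarrow>
    (\<exists>c. (\<exists>i<N. c i \<noteq> 0) \<and> (\<forall>j<N. (\<Sum>i<N. c i * g i j) = 0))"
proof -
  let ?A = "Matrix.mat N N (\<lambda>(i, j). g i j)"
  let ?T = "transpose_mat ?A"
  have T: "?T \<in> carrier_mat N N" by simp
  have prod: "?T *\<^sub>v v = 0\<^sub>v N \<longleftrightarrow> (\<forall>j<N. (\<Sum>i<N. vec_index v i * g i j) = 0)"
    if "v \<in> carrier_vec N" for v
    using that by (auto simp: vec_eq_iff scalar_prod_def lessThan_atLeast0 mult.commute)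
  have "Determinant.det ?A = 0 \<longleftrightarrow> Determinant.det ?T = 0" by (subst det_transpose[of _ N]) auto
  also have "\<dots> \<longleftrightarrow> (\<exists>v. v \<in> carrier_vec N \<and> v \<noteq> 0\<^sub>v N \<and> ?T *\<^sub>v v = 0\<^sub>v N)"
    by (rule det_0_iff_vec_prod_zero[OF T])
  also have "\<dots> \<longleftrightarrow> (\<exists>c. (\<exists>i<N. c i \<noteq> 0) \<and> (\<forall>j<N. (\<Sum>i<N. c i * g i j) = 0))"
  proof
    assume "\<exists>v. v \<in> carrier_vec N \<and> v \<noteq> 0\<^sub>v N \<and> ?T *\<^sub>v v = 0\<^sub>v N"
    then obtain v where v: "v \<in> carrier_vec N" "v \<noteq> 0\<^sub>v N" "?T *\<^sub>v v = 0\<^sub>v N" by blast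
    then have "\<exists>i<N. vec_index v i \<noteq> 0" by (auto simp: vec_eq_iff)
    then show "\<exists>c. (\<exists>i<N. c i \<noteq> 0) \<and> (\<forall>j<N. (\<Sum>i<N. c i * g i j) = 0)"
      using v prod by (intro exI[of _ "vec_index v"]) auto
  next
    assume "\<exists>c. (\<exists>i<N. c i \<noteq> 0) \<and> (\<forall>j<N. (\<Sum>i<N. c i * g i j) = 0)"
    then obtain c where c: "\<exists>i<N. c i \<noteq> 0" "\<forall>j<N. (\<Sum>i<N. c i * g i j) = 0" by blast
    let ?v = "Matrix.vec N c"
    have "?v \<noteq> 0\<^sub>v N" using c(1) by (auto simp: vec_eq_iff)
    moreover have "?T *\<^sub>v ?v = 0\<^sub>v N" using c(2) by (subst prod) auto
    ultimately show "\<exists>v. v \<in> carrier_vec N \<and> v \<noteq> 0\<^sub>v N \<and> ?T *\<^sub>v v = 0\<^sub>v N"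
      by (intro exI[of _ ?v]) auto
  qed
  finally show ?thesis .
qed

lemma det_linear_in_last_row:
  fixes g :: "nat \<Rightarrow> nat \<Rightarrow> real"
  shows "\<exists>c. \<forall>y. Determinant.det (Matrix.mat (Suc N) (Suc N) (\<lambda>(i, j). if i = N then y j else g i j))
    = (\<Sum>j<Suc N. y j * c j)"
proof (intro exI allI)
  fix y :: "nat \<Rightarrow> real"
  let ?M = "\<lambda>y. Matrix.mat (Suc N) (Suc N) (\<lambda>(i, j). if i = N then y j else g i j)"
  have "mat_delete (?M y) N j = mat_delete (?M (\<lambda>_. 0)) N j" for j
    by (rule eq_matI) (auto simp: mat_delete_def)
  then have cof: "cofactor (?M y) N j = cofactor (?M (\<lambda>_. 0)) N j" for j
    by (simp add: cofactor_def)
  have "Determinant.det (?M y) = (\<Sum>j<Suc N. ?M y $$ (N, j) * cofactor (?M y) N j)"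
    by (rule laplace_expansion_row) auto
  also have "\<dots> = (\<Sum>j<Suc N. y j * cofactor (?M (\<lambda>_. 0)) N j)"
    unfolding cof by (rule sum.cong) auto
  finally show "Determinant.det (?M y) = (\<Sum>j<Suc N. y j * cofactor (?M (\<lambda>_. 0)) N j)" .
qed

lemma W_det_linear_in_last_row:
  assumes "length \<omega>s = m + k" "length vs = m + k" "length xs = Suc k"
  shows "\<exists>c. \<forall>h r. W_det S m (\<omega>s @ [h]) (vs @ [r]) xs = (\<Sum>j<Suc (m + k).
    (if j < m then vec_index r j
     else case confluent_nodes xs ! (j - m) of (\<xi>, d) \<Rightarrow> nth_deriv_within S d h \<xi>) * c j)"
proof -
  let ?g = "\<lambda>\<omega>s (vs :: real Matrix.vec list) i j. if j < m then vec_index (vs ! i) j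
      else (case confluent_nodes xs ! (j - m) of (\<xi>, d) \<Rightarrow> nth_deriv_within S d (\<omega>s ! i) \<xi>)"
  obtain c where c: "\<forall>y. Determinant.det (Matrix.mat (Suc (m + k)) (Suc (m + k))
      (\<lambda>(i, j). if i = m + k then y j else ?g \<omega>s vs i j)) = (\<Sum>j<Suc (m + k). y j * c j)"
    using det_linear_in_last_row[of "m + k" "?g \<omega>s vs"] by blast
  have "W_det S m (\<omega>s @ [h]) (vs @ [r]) xs = (\<Sum>j<Suc (m + k).
    (if j < m then vec_index r j
     else case confluent_nodes xs ! (j - m) of (\<xi>, d) \<Rightarrow> nth_deriv_within S d h \<xi>) * c j)" for h r
  proof -
    have "W_det S m (\<omega>s @ [h]) (vs @ [r]) xs = Determinant.det (Matrix.mat (Suc (m + k)) (Suc (m + k))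
      (\<lambda>(i, j). if i = m + k then (if j < m then vec_index r j
     else case confluent_nodes xs ! (j - m) of (\<xi>, d) \<Rightarrow> nth_deriv_within S d h \<xi>) else ?g \<omega>s vs i j))"
      unfolding W_det_def using assms
      by (intro arg_cong[where f = Determinant.det] eq_matI)
        (auto simp: nth_append less_Suc_eq split: prod.splits)
    then show ?thesis using c by simp
  qed
  then show ?thesis by blast
qed

lemma set_confluent_nodes:
  "set (confluent_nodes xs) = Sigma (set xs) (\<lambda>x. {..<count_list xs x})"
  by (auto simp: confluent_nodes_def)

lemma card_confluent_nodes: "card (set (confluent_nodes xs)) = length xs"
  by (simp add: set_confluent_nodes card_SigmaI sum_count_set)

text \<open>
  Nodes that are not all equal have multiplicities less than their number. Hence at \<open>k + 1\<close> such
  nodes only derivatives of order less than \<open>k\<close> occur, and these exist also at \<open>a\<close> and \<open>b\<close>.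
\<close>

lemma confluent_nodes_order_less:
  assumes "Min (set xs) < Max (set xs)" "(x, j) \<in> set (confluent_nodes xs)"
  shows "Suc j < length xs"
proof -
  have ne: "set xs \<noteq> {}" using assms(2) by (auto simp: set_confluent_nodes)
  obtain y where y: "y \<in> set xs" "y \<noteq> x"
    using assms(1) Min_in[OF finite_set ne] Max_in[OF finite_set ne] by (metis less_irrefl)
  then have "length (filter ((=) x) xs) < length xs" by (intro length_filter_less) auto
  then show ?thesis using assms(2) by (simp add: set_confluent_nodes count_list_eq_length_filter)
qed

lemma set_confluent_nodes_replicate:
  "set (confluent_nodes (replicate n \<xi>)) = {\<xi>} \<times> {..<n}"
proof -
  have "count_list (replicate n \<xi>) \<xi> = n" by (induction n) auto
  then show ?thesis by (auto simp: set_confluent_nodes)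
qed

lemma W_det_eq_0_iff:
  assumes "length xs = l"
  shows "W_det S m \<omega>s vs xs = 0 \<longleftrightarrow> (\<exists>c. (\<exists>i<m + l. c i \<noteq> 0) \<and>
    (\<forall>j<m. (\<Sum>i<m + l. c i * vec_index (vs ! i) j) = 0) \<and>
    (\<forall>p\<in>set (confluent_nodes xs).
      (\<Sum>i<m + l. c i * nth_deriv_within S (snd p) (\<omega>s ! i) (fst p)) = 0))"
proof -
  have all: "(\<forall>j<m + l. P j) \<longleftrightarrow> (\<forall>j<m. P j) \<and> (\<forall>j<l. P (m + j))" for P
    by (metis add_diff_inverse_nat nat_add_left_cancel_less trans_less_add1)
  have nodes: "(\<forall>p\<in>set (confluent_nodes xs). P p) \<longleftrightarrow> (\<forall>j<l. P (confluent_nodes xs ! j))" for P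
    using assms by (simp add: all_set_conv_all_nth length_confluent_nodes)
  show ?thesis
    unfolding W_det_def assms det_eq_0_iff_row_combination all nodes
    by (simp add: case_prod_beta)
qed

lemma sum_lessThan_add:
  fixes f :: "nat \<Rightarrow> real"
  shows "(\<Sum>i<m + n. f i) = (\<Sum>i<m. f i) + (\<Sum>i<n. f (m + i))"
  by (induction n) auto

text \<open>
  \<open>u i\<close> is the vector part of row \<open>i\<close> and \<open>L p i\<close> its entry in the column \<open>p\<close>. Subtracting from each
  row \<open>m + i\<close> the combination of the first \<open>m\<close> rows with the same vector part clears the vector
  columns below the independent block formed by these \<open>m\<close> rows.
\<close>

lemma eliminate_vectors:
  fixes u :: "nat \<Rightarrow> nat \<Rightarrow> real" and L :: "'p \<Rightarrow> nat \<Rightarrow> real"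
  assumes rel: "\<And>i j. i < l \<Longrightarrow> j < m \<Longrightarrow> u (m + i) j = (\<Sum>t<m. \<alpha> i t * u t j)"
    and indep: "\<And>c t. (\<And>j. j < m \<Longrightarrow> (\<Sum>t<m. c t * u t j) = 0) \<Longrightarrow> t < m \<Longrightarrow> c t = 0"
  shows "(\<exists>c. (\<exists>i<m + l. c i \<noteq> 0) \<and> (\<forall>j<m. (\<Sum>i<m + l. c i * u i j) = 0) \<and>
      (\<forall>p\<in>P. (\<Sum>i<m + l. c i * L p i) = 0)) \<longleftrightarrow>
    (\<exists>e. (\<exists>i<l. e i \<noteq> 0) \<and> (\<forall>p\<in>P. (\<Sum>i<l. e i * (L p (m + i) - (\<Sum>t<m. \<alpha> i t * L p t))) = 0))"
    (is "?lhs \<longleftrightarrow> ?rhs")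
proof -
  have key: "(\<Sum>i<m + l. c i * y i) = (\<Sum>i<l. c (m + i) * (y (m + i) - (\<Sum>t<m. \<alpha> i t * y t))) +
      (\<Sum>t<m. (c t + (\<Sum>i<l. c (m + i) * \<alpha> i t)) * y t)" for c y :: "nat \<Rightarrow> real"
  proof -
    have "(\<Sum>i<l. \<Sum>t<m. c (m + i) * (\<alpha> i t * y t)) = (\<Sum>t<m. \<Sum>i<l. c (m + i) * (\<alpha> i t * y t))"
      by (rule sum.swap)
    then show ?thesis unfolding sum_lessThan_add
      by (simp add: algebra_simps sum.distrib sum_subtractf sum_distrib_left
          sum_distrib_right)
  qed
  show ?thesis
  proof
    assume ?lhs
    then obtain c where c: "\<exists>i<m + l. c i \<noteq> 0" "\<And>j. j < m \<Longrightarrow> (\<Sum>i<m + l. c i * u i j) = 0"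
      "\<And>p. p \<in> P \<Longrightarrow> (\<Sum>i<m + l. c i * L p i) = 0" by blast
    have b: "c t + (\<Sum>i<l. c (m + i) * \<alpha> i t) = 0" if "t < m" for t
    proof (rule indep[OF _ that])
      fix j assume "j < m"
      then show "(\<Sum>t<m. (c t + (\<Sum>i<l. c (m + i) * \<alpha> i t)) * u t j) = 0"
        using key[of c "\<lambda>i. u i j"] c(2)[of j] rel[of _ j] by simp
    qed
    have "\<exists>i<l. c (m + i) \<noteq> 0"
    proof (rule ccontr)
      assume "\<not> ?thesis"
      then have "c (m + i) = 0" if "i < l" for i using that by blast
      moreover from this have "c t = 0" if "t < m" for t using b[OF that] by simp
      ultimately have "c i = 0" if "i < m + l" for i
        using that by (metis add_diff_inverse_nat nat_add_left_cancel_less)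
      then show False using c(1) by blast
    qed
    moreover have "(\<Sum>i<l. c (m + i) * (L p (m + i) - (\<Sum>t<m. \<alpha> i t * L p t))) = 0" if "p \<in> P" for p
      using key[of c "L p"] c(3)[OF that] b by simp
    ultimately show ?rhs by (intro exI[of _ "\<lambda>i. c (m + i)"]) auto
  next
    assume ?rhs
    then obtain e where e: "\<exists>i<l. e i \<noteq> 0"
      "\<And>p. p \<in> P \<Longrightarrow> (\<Sum>i<l. e i * (L p (m + i) - (\<Sum>t<m. \<alpha> i t * L p t))) = 0" by blast
    define c where "c i = (if i < m then - (\<Sum>i'<l. e i' * \<alpha> i' i) else e (i - m))" for i
    have c: "(\<Sum>i<m + l. c i * y i) = (\<Sum>i<l. e i * (y (m + i) - (\<Sum>t<m. \<alpha> i t * y t)))" for y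
      unfolding key by (simp add: c_def)
    have "\<exists>i<m + l. c i \<noteq> 0" using e(1) by (metis c_def add_diff_cancel_left' nat_add_left_cancel_less not_add_less1)
    then show ?lhs using e(2) rel by (intro exI[of _ c]) (simp add: c)
  qed
qed

lemma rows_independent:
  fixes vs :: "real Matrix.vec list"
  assumes "m > 0 \<longrightarrow> Determinant.det (mat_of_rows m (take m vs)) \<noteq> 0" "m \<le> length vs"
    and "\<And>j. j < m \<Longrightarrow> (\<Sum>t<m. c t * vec_index (vs ! t) j) = 0" "t < m"
  shows "c t = 0"
proof -
  have "mat_of_rows m (take m vs) = Matrix.mat m m (\<lambda>(i, j). vec_index (vs ! i) j)"
    using assms(2) by (intro eq_matI) (auto simp: mat_of_rows_def)
  then have "\<not> (\<exists>c. (\<exists>i<m. c i \<noteq> 0) \<and> (\<forall>j<m. (\<Sum>i<m. c i * vec_index (vs ! i) j) = 0))"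
    using assms(1,4) det_eq_0_iff_row_combination[of m "\<lambda>i. vec_index (vs ! i)"] by auto
  then show ?thesis using assms(3,4) by blast
qed

lemma rows_span:
  fixes vs :: "real Matrix.vec list"
  assumes "m > 0 \<longrightarrow> Determinant.det (mat_of_rows m (take m vs)) \<noteq> 0" "m \<le> length vs"
  shows "\<exists>\<alpha>. \<forall>j<m. y j = (\<Sum>t<m. \<alpha> t * vec_index (vs ! t) j)"
proof (cases "m = 0")
  case False
  let ?U = "Matrix.mat m m (\<lambda>(i, j). vec_index (vs ! i) j)"
  have "mat_of_rows m (take m vs) = ?U"
    using assms(2) by (intro eq_matI) (auto simp: mat_of_rows_def)
  then have "?U \<in> Units (ring_mat TYPE(real) m ())"
    using assms(1) False by (intro det_non_zero_imp_unit) auto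
  then obtain B where B: "B \<in> carrier_mat m m" "B * ?U = 1\<^sub>m m"
    by (auto simp: Units_def ring_mat_def)
  define \<alpha> where "\<alpha> t = (\<Sum>i<m. y i * B $$ (i, t))" for t
  have "(\<Sum>t<m. \<alpha> t * vec_index (vs ! t) j) = y j" if j: "j < m" for j
  proof -
    have BU: "(\<Sum>t<m. B $$ (i, t) * vec_index (vs ! t) j) = (if i = j then 1 else 0)" if "i < m" for i
    proof -
      have "(B * ?U) $$ (i, j) = (\<Sum>t<m. B $$ (i, t) * vec_index (vs ! t) j)"
        using B(1) that j by (auto simp: scalar_prod_def lessThan_atLeast0 intro!: sum.cong)
      then show ?thesis using that j by (simp add: B(2))
    qed
    have "(\<Sum>t<m. \<alpha> t * vec_index (vs ! t) j) = (\<Sum>t<m. \<Sum>i<m. y i * (B $$ (i, t) * vec_index (vs ! t) j))"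
      by (simp add: \<alpha>_def sum_distrib_right mult.assoc)
    also have "\<dots> = (\<Sum>i<m. y i * (\<Sum>t<m. B $$ (i, t) * vec_index (vs ! t) j))"
      by (subst sum.swap) (simp add: sum_distrib_left)
    also have "\<dots> = (\<Sum>i<m. if i = j then y i else 0)"
      by (intro sum.cong) (auto simp: BU)
    finally show ?thesis using j by simp
  qed
  then show ?thesis by (intro exI[of _ \<alpha>]) simp
qed simp

section \<open>Derivatives in the class D\<close>

context
  fixes a b :: real
  assumes ab: "a < b"
begin

text \<open>
  \<open>d\<close> and \<open>D j\<close> are the derivative and the \<open>j\<close>-th derivative within \<open>[a, b]\<close>.
\<close>

private abbreviation (input) d :: "(real \<Rightarrow> real) \<Rightarrow> real \<Rightarrow> real" where
  "d f \<equiv> \<lambda>x. vector_derivative f (at x within {a..b})"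

private abbreviation (input) D :: "nat \<Rightarrow> (real \<Rightarrow> real) \<Rightarrow> real \<Rightarrow> real" where
  "D \<equiv> nth_deriv_within {a..b}"

text \<open>
  Admissibility of \<open>(j, x)\<close>: a function of class \<open>D_class k a b\<close> has a meaningful \<open>j\<close>-th derivative
  at \<open>x\<close>. The order \<open>k\<close> is admissible only in the open interval.
\<close>

private abbreviation (input) adm :: "nat \<Rightarrow> nat \<Rightarrow> real \<Rightarrow> bool" where
  "adm k j x \<equiv> j < k \<and> x \<in> {a..b} \<or> j = k \<and> x \<in> {a<..<b}"

lemma D_0: "D 0 f = f"
  by (simp add: nth_deriv_within_def)

lemma D_Suc: "D (Suc j) f = D j (d f)"
  by (simp add: nth_deriv_within_def funpow_Suc_right del: funpow.simps)

lemma d_eqI: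
  assumes "x \<in> {a..b}" "(f has_real_derivative y) (at x within {a..b})"
  shows "d f x = y"
  using vector_derivative_within_cbox[of a b x f y] ab assms
  by (simp add: has_real_derivative_iff_has_vector_derivative)

lemma has_d:
  assumes "f differentiable (at x within {a..b})"
  shows "(f has_real_derivative d f x) (at x within {a..b})"
  using assms vector_derivative_works
  by (auto simp: has_real_derivative_iff_has_vector_derivative)

lemma d_cong:
  assumes "\<And>y. y \<in> {a..b} \<Longrightarrow> f y = g y" "x \<in> {a..b}"
  shows "d f x = d g x"
  using assms by (intro vector_derivative_cong_eq) auto

lemma D_cong:
  assumes "\<And>y. y \<in> {a..b} \<Longrightarrow> f y = g y" "x \<in> {a..b}"
  shows "D j f x = D j g x"
  using assms
proof (induction j arbitrary: f g x)
  case (Suc j)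
  have "d f y = d g y" if "y \<in> {a..b}" for y using Suc.prems(1) that by (rule d_cong)
  then show ?case using Suc.IH[of "d f" "d g" x] Suc.prems(2) by (simp add: D_Suc)
qed (simp add: D_0)

lemma d_axpy:
  assumes "x \<in> {a..b}" "f differentiable (at x within {a..b})" "g differentiable (at x within {a..b})"
  shows "d (\<lambda>x. c * f x + g x) x = c * d f x + d g x"
  by (rule d_eqI[OF assms(1)]) (auto intro!: derivative_eq_intros has_d assms)

lemma d_mult:
  assumes "x \<in> {a..b}" "f differentiable (at x within {a..b})" "g differentiable (at x within {a..b})"
  shows "d (\<lambda>x. f x * g x) x = d f x * g x + f x * d g x"
  by (rule d_eqI[OF assms(1)]) (auto intro!: derivative_eq_intros has_d assms)

lemma D_class_1:
  "f \<in> D_class (Suc 0) a b \<longleftrightarrow>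
    continuous_on {a..b} f \<and> (\<forall>x\<in>{a<..<b}. f differentiable (at x within {a..b}))"
  by (auto simp: D_class_def D_0 differentiable_on_def at_within_Icc_at
      at_within_open[of _ "{a<..<b}"])

lemma D_class_Suc:
  assumes "1 \<le> k"
  shows "f \<in> D_class (Suc k) a b \<longleftrightarrow> f differentiable_on {a..b} \<and> d f \<in> D_class k a b"
proof -
  obtain k' where k: "k = Suc k'" using assms by (cases k) auto
  have "(\<forall>j<Suc k'. D j f differentiable_on {a..b}) \<longleftrightarrow>
      f differentiable_on {a..b} \<and> (\<forall>j<k'. D j (d f) differentiable_on {a..b})"
    by (auto simp: All_less_Suc2 D_0 D_Suc)
  then show ?thesis by (auto simp: D_class_def k D_Suc)
qed

lemma D_class_differentiable:
  assumes "f \<in> D_class k a b" "1 \<le> k" "adm k 1 x"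
  shows "f differentiable (at x within {a..b})"
proof (cases "k = 1")
  case True
  then show ?thesis using assms D_class_1 by auto
next
  case False
  then obtain k' where "k = Suc k'" "1 \<le> k'" using assms by (cases k) auto
  then show ?thesis using assms D_class_Suc[of k' f] by (auto simp: differentiable_on_def)
qed

lemma D_class_SucD:
  assumes "f \<in> D_class (Suc k) a b" "1 \<le> k"
  shows "f \<in> D_class k a b"
  using assms(2,1)
proof (induction k arbitrary: f rule: nat_induct_at_least)
  case base
  then have "f differentiable_on {a..b}" using D_class_Suc[of 1 f] by auto
  then show ?case
    by (auto simp: D_class_1 differentiable_imp_continuous_on) (auto simp: differentiable_on_def)
next
  case (Suc k)
  then show ?case using D_class_Suc[of k f] D_class_Suc[of "Suc k" f] by auto
qed

lemma D_class_imp_D_class_1: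
  assumes "f \<in> D_class k a b" "1 \<le> k"
  shows "f \<in> D_class (Suc 0) a b"
  using assms(2,1) 
proof (induction k rule: nat_induct_at_least)
  case (Suc k)
  then show ?case using D_class_SucD by blast
qed simp

lemma D_class_cong:
  assumes "1 \<le> k" "f \<in> D_class k a b" "\<And>x. x \<in> {a..b} \<Longrightarrow> f x = g x"
  shows "g \<in> D_class k a b"
proof -
  have diff: "h differentiable (at x within S) \<Longrightarrow> (\<And>y. y \<in> S \<Longrightarrow> h y = h' y) \<Longrightarrow> x \<in> S
      \<Longrightarrow> h' differentiable (at x within S)" for h h' :: "real \<Rightarrow> real" and x S
    by (erule differentiable_transform_within[where d=1]) auto
  have eq: "D j f x = D j g x" if "x \<in> {a..b}" for j x
    using that assms(3) by (intro D_cong) auto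
  show ?thesis
    using assms(2) unfolding D_class_def mem_Collect_eq
  proof (elim conjE, intro conjI allI impI)
    fix j assume "\<forall>j<k - 1. D j f differentiable_on {a..b}" "j < k - 1"
    then show "D j g differentiable_on {a..b}"
      unfolding differentiable_on_def using eq diff by blast
  next
    assume "continuous_on {a..b} (D (k - 1) f)"
    then show "continuous_on {a..b} (D (k - 1) g)" by (rule continuous_on_eq) (rule eq)
  next
    assume "D (k - 1) f differentiable_on {a<..<b}"
    then show "D (k - 1) g differentiable_on {a<..<b}"
      unfolding differentiable_on_def using eq diff[of "D (k - 1) f" _ "{a<..<b}" "D (k - 1) g"]
      by auto
  qed
qed

lemma D_class_axpy:
  assumes "1 \<le> k" "f \<in> D_class k a b" "g \<in> D_class k a b"
  shows "(\<lambda>x. c * f x + g x) \<in> D_class k a b"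
  using assms
proof (induction k arbitrary: f g rule: nat_induct_at_least)
  case base
  then show ?case by (auto simp: D_class_1 intro!: continuous_intros derivative_intros)
next
  case (Suc k)
  then have fg: "f differentiable_on {a..b}" "g differentiable_on {a..b}"
    "d f \<in> D_class k a b" "d g \<in> D_class k a b"
    by (auto simp: D_class_Suc)
  have "d (\<lambda>x. c * f x + g x) \<in> D_class k a b"
    using fg(1,2)
    by (intro D_class_cong[OF Suc(1) Suc(2)[OF fg(3,4)]])
      (auto simp: differentiable_on_def d_axpy)
  with fg(1,2) show ?case by (auto simp: D_class_Suc[OF Suc(1)] intro!: derivative_intros)
qed

lemma D_class_mult:
  assumes "1 \<le> k" "f \<in> D_class k a b" "g \<in> D_class k a b"
  shows "(\<lambda>x. f x * g x) \<in> D_class k a b"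
  using assms
proof (induction k arbitrary: f g rule: nat_induct_at_least)
  case base
  then show ?case by (auto simp: D_class_1 intro!: continuous_intros derivative_intros)
next
  case (Suc k)
  then have fg: "f differentiable_on {a..b}" "g differentiable_on {a..b}"
    "d f \<in> D_class k a b" "d g \<in> D_class k a b"
    by (auto simp: D_class_Suc)
  have fg': "f \<in> D_class k a b" "g \<in> D_class k a b" using Suc D_class_SucD by auto
  have "(\<lambda>x. 1 * (d f x * g x) + f x * d g x) \<in> D_class k a b"
    using Suc.hyps Suc.IH[OF fg(3) fg'(2)] Suc.IH[OF fg'(1) fg(4)] by (rule D_class_axpy)
  then have "d (\<lambda>x. f x * g x) \<in> D_class k a b"
    by (rule D_class_cong[OF Suc.hyps])
      (use fg(1,2) in \<open>auto simp: differentiable_on_def d_mult\<close>)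
  with fg(1,2) show ?case by (auto simp: D_class_Suc[OF Suc.hyps] intro!: derivative_intros)
qed

lemma d_const: "x \<in> {a..b} \<Longrightarrow> d (\<lambda>_. c) x = 0"
  by (rule d_eqI) auto

lemma D_const: "x \<in> {a..b} \<Longrightarrow> D j (\<lambda>_. c) x = (if j = 0 then c else 0)"
proof (induction j arbitrary: c)
  case (Suc j)
  have "D j (d (\<lambda>_. c)) x = D j (\<lambda>_. 0) x" using Suc by (intro D_cong d_const) auto
  then show ?case using Suc by (simp add: D_Suc)
qed (simp add: D_0)

lemma D_class_const:
  assumes "1 \<le> k"
  shows "(\<lambda>_. c) \<in> D_class k a b"
  using assms
proof (induction k arbitrary: c rule: nat_induct_at_least)
  case base
  show ?case by (auto simp: D_class_1)
next
  case (Suc k)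
  have "d (\<lambda>_. c) \<in> D_class k a b"
    using Suc by (intro D_class_cong[OF Suc.hyps Suc.IH[of 0]]) (auto simp: d_const)
  then show ?case by (auto simp: D_class_Suc[OF Suc.hyps])
qed

lemma D_class_inverse:
  assumes "1 \<le> k" "f \<in> D_class k a b" and nz: "\<And>x. x \<in> {a..b} \<Longrightarrow> f x \<noteq> 0"
  shows "(\<lambda>x. inverse (f x)) \<in> D_class k a b"
  using assms(1,2)
proof (induction k rule: nat_induct_at_least)
  case base
  then show ?case using nz
    by (auto simp: D_class_1 intro!: continuous_intros derivative_intros)
next
  case (Suc k)
  then have f: "f differentiable_on {a..b}" "d f \<in> D_class k a b" by (auto simp: D_class_Suc)
  have inv: "(\<lambda>x. inverse (f x)) \<in> D_class k a b" using Suc D_class_SucD by auto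
  have "(\<lambda>x. -1 * (d f x * (inverse (f x) * inverse (f x))) + 0) \<in> D_class k a b"
    using f inv Suc.hyps by (intro D_class_axpy D_class_mult D_class_const) auto
  then have "d (\<lambda>x. inverse (f x)) \<in> D_class k a b"
  proof (rule D_class_cong[OF Suc.hyps])
    show "-1 * (d f x * (inverse (f x) * inverse (f x))) + 0 = d (\<lambda>x. inverse (f x)) x"
      if "x \<in> {a..b}" for x
      by (rule sym, rule d_eqI) (use f nz that in \<open>auto simp: differentiable_on_def field_simps
          intro!: derivative_eq_intros has_d\<close>)
  qed
  moreover have "(\<lambda>x. inverse (f x)) differentiable_on {a..b}"
    using f nz by (auto simp: differentiable_on_def intro!: derivative_intros)
  ultimately show ?case by (auto simp: D_class_Suc[OF Suc.hyps])
qed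

lemma D_class_divide:
  assumes "1 \<le> k" "f \<in> D_class k a b" "g \<in> D_class k a b" "\<And>x. x \<in> {a..b} \<Longrightarrow> g x \<noteq> 0"
  shows "(\<lambda>x. f x / g x) \<in> D_class k a b"
  unfolding divide_inverse using assms by (intro D_class_mult D_class_inverse) auto

lemma D_axpy:
  assumes "1 \<le> k" "f \<in> D_class k a b" "g \<in> D_class k a b" "adm k j x"
  shows "D j (\<lambda>x. c * f x + g x) x = c * D j f x + D j g x"
  using assms
proof (induction j arbitrary: k f g)
  case (Suc j)
  have x: "x \<in> {a..b}" using Suc.prems by auto
  show ?case
  proof (cases "k = 1")
    case True
    then have "j = 0" using Suc.prems by auto
    moreover have "f differentiable (at x within {a..b})" "g differentiable (at x within {a..b})"
      using Suc.prems True \<open>j = 0\<close> by (auto simp: D_class_1)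
    ultimately show ?thesis using d_axpy x by (simp add: D_Suc D_0)
  next
    case False
    then obtain k' where k: "k = Suc k'" "1 \<le> k'" using Suc.prems by (cases k) auto
    have fg: "f differentiable_on {a..b}" "g differentiable_on {a..b}"
      "d f \<in> D_class k' a b" "d g \<in> D_class k' a b"
      using Suc.prems k by (auto simp: D_class_Suc)
    have "D j (d (\<lambda>x. c * f x + g x)) x = D j (\<lambda>x. c * d f x + d g x) x"
      using fg x by (intro D_cong d_axpy) (auto simp: differentiable_on_def)
    also have "\<dots> = c * D j (d f) x + D j (d g) x"
      using Suc.IH[OF k(2) fg(3,4)] Suc.prems k by auto
    finally show ?thesis by (simp add: D_Suc)
  qed
qed (simp add: D_0)

lemma D_class_sum:
  fixes n :: nat
  assumes "1 \<le> k" "\<And>i. i < n \<Longrightarrow> f i \<in> D_class k a b"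
  shows "(\<lambda>x. \<Sum>i<n. c i * f i x) \<in> D_class k a b"
  using assms(2)
proof (induction n)
  case (Suc n)
  have "(\<lambda>x. c n * f n x + (\<Sum>i<n. c i * f i x)) \<in> D_class k a b"
    using Suc by (intro D_class_axpy[OF assms(1)]) auto
  then show ?case by (simp add: add.commute)
qed (use D_class_const assms(1) in auto)

lemma D_sum:
  fixes n :: nat
  assumes "1 \<le> k" "\<And>i. i < n \<Longrightarrow> f i \<in> D_class k a b" "adm k j x"
  shows "D j (\<lambda>x. \<Sum>i<n. c i * f i x) x = (\<Sum>i<n. c i * D j (f i) x)"
  using assms(2)
proof (induction n)
  case 0
  then show ?case using assms by (auto simp: D_const)
next
  case (Suc n)
  have "D j (\<lambda>x. c n * f n x + (\<Sum>i<n. c i * f i x)) x = c n * D j (f n) x + D j (\<lambda>x. \<Sum>i<n. c i * f i x) x"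
    using Suc assms by (intro D_axpy[OF assms(1)] D_class_sum) auto
  then show ?case using Suc by (simp add: add.commute)
qed

text \<open>
  Qualitative form of the Leibniz rule: multiplication by a smooth enough \<open>g\<close> preserves vanishing
  to a given order.
\<close>

lemma D_mult_vanish:
  assumes "1 \<le> k" "f \<in> D_class k a b" "g \<in> D_class k a b" "adm k n x"
    and "\<And>i. i \<le> n \<Longrightarrow> D i f x = 0"
  shows "D n (\<lambda>x. f x * g x) x = 0"
  using assms
proof (induction n arbitrary: k f g)
  case 0
  then show ?case by (auto simp: D_0)
next
  case (Suc n)
  have x: "x \<in> {a..b}" using Suc.prems by auto
  show ?case
  proof (cases "k = 1")
    case True
    then have n: "n = 0" using Suc.prems by auto
    moreover have "f differentiable (at x within {a..b})" "g differentiable (at x within {a..b})"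
      using Suc.prems True n by (auto simp: D_class_1)
    moreover have "f x = 0" "d f x = 0"
      using Suc.prems(5)[of 0] Suc.prems(5)[of 1] n by (auto simp: D_Suc D_0)
    ultimately show ?thesis using d_mult x by (simp add: D_Suc D_0)
  next
    case False
    then obtain k' where k: "k = Suc k'" "1 \<le> k'" using Suc.prems by (cases k) auto
    have fg: "f differentiable_on {a..b}" "g differentiable_on {a..b}"
      "d f \<in> D_class k' a b" "d g \<in> D_class k' a b"
      using Suc.prems k by (auto simp: D_class_Suc)
    have fg': "f \<in> D_class k' a b" "g \<in> D_class k' a b"
      using Suc.prems k D_class_SucD by auto
    have n: "adm k' n x" using Suc.prems k by auto
    have "D n (d (\<lambda>x. f x * g x)) x = D n (\<lambda>x. 1 * (d f x * g x) + f x * d g x) x"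
      using fg x by (intro D_cong) (auto simp: differentiable_on_def d_mult)
    also have "\<dots> = 1 * D n (\<lambda>x. d f x * g x) x + D n (\<lambda>x. f x * d g x) x"
      using fg fg' k n by (intro D_axpy[of k'] D_class_mult) auto
    also have "D n (\<lambda>x. d f x * g x) x = 0"
      using Suc.prems(5) by (intro Suc.IH[OF k(2) fg(3) fg'(2) n]) (auto simp flip: D_Suc)
    also have "D n (\<lambda>x. f x * d g x) x = 0"
      using Suc.prems(5) by (intro Suc.IH[OF k(2) fg'(1) fg(4) n]) auto
    finally show ?thesis by (simp add: D_Suc)
  qed
qed


section \<open>The theorem of Rolle with multiplicities\<close>

text \<open>
  Rolle's theorem in all gaps of a finite set of zeros at once. The points found are disjoint from
  the zeros, hence do not interfere with zeros of the derivative inherited from multiple zeros.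
\<close>

lemma rolle_points:
  assumes f: "f \<in> D_class (Suc 0) a b"
    and "finite Z" "Z \<noteq> {}" "Z \<subseteq> {a..b}" "\<And>z. z \<in> Z \<Longrightarrow> f z = 0"
  shows "\<exists>Y. finite Y \<and> Suc (card Y) = card Z \<and> Y \<inter> Z = {} \<and> Y \<subseteq> {Min Z<..<Max Z} \<and>
    (\<forall>y\<in>Y. d f y = 0)"
  using assms(2-)
proof (induction Z rule: finite_linorder_max_induct)
  case (insert z Z)
  show ?case
  proof (cases "Z = {}")
    case False
    then obtain Y where Y: "finite Y" "Suc (card Y) = card Z" "Y \<inter> Z = {}"
      "Y \<subseteq> {Min Z<..<Max Z}" "\<forall>y\<in>Y. d f y = 0"
      using insert.IH insert.prems by auto
    define z' where "z' = Max Z"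
    have z': "z' \<in> Z" "z' < z" "\<And>x. x \<in> Z \<Longrightarrow> x \<le> z'"
      using insert.hyps False by (auto simp: z'_def)
    have zz: "{z'..z} \<subseteq> {a..b}" using z' insert.prems by auto
    have "\<exists>y. z' < y \<and> y < z \<and> (\<lambda>h. h * d f y) = (\<lambda>h. 0)"
    proof (rule Rolle_deriv[OF z'(2)])
      show "f z' = f z" using insert.prems(3) z'(1) by simp
      show "continuous_on {z'..z} f" using f zz D_class_1 continuous_on_subset by blast
      fix x assume x: "z' < x" "x < z"
      then have "x \<in> {a<..<b}" using zz by (auto simp: subset_iff intro: le_less_trans less_le_trans)
      then show "(f has_derivative (\<lambda>h. h * d f x)) (at x)"
        using has_d[of f x] f
        by (simp add: D_class_1 has_field_derivative_def at_within_Icc_at mult_commute_abs)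
    qed
    then obtain y where y: "z' < y" "y < z" "d f y = 0" by (metis mult_1)
    have "y \<notin> Y" using y Y(4) by (auto simp: z'_def)
    moreover have "y \<notin> Z" "y \<noteq> z" using y z' by fastforce+
    moreover have "z \<notin> Y" using Y(4) z' by (auto simp: z'_def)
    moreover have "z \<notin> Z" using z' by force
    moreover have "Max (insert z Z) = z" "Min (insert z Z) = Min Z"
      using z' insert.hyps False by (auto intro!: Max_eqI simp: Min_insert min_def)
        (meson Min_in insert.hyps(2) less_le_trans order_less_irrefl)
    moreover have "Min Z < y" using y z' insert.hyps by (metis Min_le le_less_trans)
    moreover have "Y \<subseteq> {Min Z<..<z}" using Y(4) z' by (auto simp: z'_def)
    ultimately show ?thesis
      using Y y insert.hyps by (intro exI[of _ "insert y Y"]) auto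
  qed (auto intro: exI[of _ "{}"])
qed simp

text \<open>
  \<open>zero_set f P\<close>: the finite set \<open>P\<close> records zeros of \<open>f\<close> with multiplicity. A zero \<open>x\<close> counted
  with multiplicity \<open>\<mu>\<close> is represented by the pairs \<open>(x, 0), \<dots>, (x, \<mu> - 1)\<close>, so \<open>card P\<close> is the
  number of recorded zeros; the actual multiplicities may be larger.
\<close>

definition zero_set :: "(real \<Rightarrow> real) \<Rightarrow> (real \<times> nat) set \<Rightarrow> bool" where
  "zero_set f P \<longleftrightarrow> finite P \<and> (\<forall>x j. (x, Suc j) \<in> P \<longrightarrow> (x, j) \<in> P) \<and>
    (\<forall>(x, j) \<in> P. D j f x = 0)"

lemma zero_set_base:
  assumes "zero_set f P" "(x, j) \<in> P" "i \<le> j"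
  shows "(x, i) \<in> P"
  using assms(3,2)
proof (induction rule: inc_induct)
  case (step i)
  then show ?case using assms(1) by (auto simp: zero_set_def)
qed

lemma zero_set_D:
  assumes "zero_set f P" "(x, j) \<in> P" "i \<le> j"
  shows "D i f x = 0"
  using zero_set_base[OF assms] assms(1) by (auto simp: zero_set_def)

lemma zero_set_fst:
  assumes "zero_set f P"
  shows "fst ` P = {x. (x, 0) \<in> P}"
  using zero_set_base[OF assms, of _ _ 0] by force

text \<open>
  The derivative loses exactly one recorded zero. The last conjunct keeps track of the zeros not
  being all at one point, which is needed to apply the lemma repeatedly.
\<close>

lemma rolle_multiplicities:
  assumes f: "f \<in> D_class (Suc 0) a b" and P: "zero_set f P" "P \<noteq> {}"
    and lr: "fst ` P \<subseteq> {l..r}" "{l..r} \<subseteq> {a..b}"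
  shows "\<exists>P'. zero_set (d f) P' \<and> Suc (card P') = card P \<and> fst ` P' \<subseteq> {l..r} \<and>
    (\<forall>(x, j) \<in> P'. j = 0 \<or> (x, Suc j) \<in> P) \<and>
    (3 \<le> card P \<longrightarrow> 2 \<le> card (fst ` P) \<longrightarrow> 2 \<le> card (fst ` P'))"
proof -
  define Z where "Z = fst ` P"
  have Z: "Z = {x. (x, 0) \<in> P}" using zero_set_fst[OF P(1)] by (simp add: Z_def)
  have fin: "finite P" "finite Z" using P(1) by (auto simp: zero_set_def Z_def)
  have ZZ: "Z \<noteq> {}" "Z \<subseteq> {l..r}" "Z \<subseteq> {a..b}" using P(2) lr by (auto simp: Z_def)
  have "f z = 0" if "z \<in> Z" for z
    using that zero_set_D[OF P(1), of z 0 0] by (auto simp: Z D_0)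
  then obtain Y where Y: "finite Y" "Suc (card Y) = card Z" "Y \<inter> Z = {}"
      "Y \<subseteq> {Min Z<..<Max Z}" "\<forall>y\<in>Y. d f y = 0"
    using rolle_points[OF f fin(2) ZZ(1,3)] by blast
  \<comment> \<open>\<open>Q\<close> collects the zeros of the derivative inherited from multiple zeros of \<open>f\<close>.\<close>
  define Q where "Q = {(x, j). (x, Suc j) \<in> P}"
  define P' where "P' = Q \<union> Y \<times> {0}"
  have Peq: "P = Z \<times> {0} \<union> map_prod id Suc ` Q"
  proof (rule Set.set_eqI)
    fix p :: "real \<times> nat"
    show "p \<in> P \<longleftrightarrow> p \<in> Z \<times> {0} \<union> map_prod id Suc ` Q"
      by (cases p; cases "snd p") (auto simp: Z Q_def image_iff)
  qed
  have finQ: "finite Q"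
    using fin(1) Peq by (metis finite_Un finite_imageD inj_Suc inj_on_subset prod.inj_map inj_on_id subset_UNIV)
  have "card P = card (Z \<times> {0::nat}) + card (map_prod id Suc ` Q)"
    unfolding Peq using fin finQ by (intro card_Un_disjoint) auto
  then have cP: "card P = card Z + card Q"
    by (simp add: card_cartesian_product card_image inj_on_subset[OF prod.inj_map[OF inj_on_id inj_Suc]])
  have QZ: "fst ` Q \<subseteq> Z" by (force simp: Q_def Z_def)
  have "card P' = card Q + card (Y \<times> {0::nat})"
    unfolding P'_def using finQ Y(1,3) QZ by (intro card_Un_disjoint) force+
  then have cP': "Suc (card P') = card P" using cP Y(2) by (simp add: card_cartesian_product)
  have "zero_set (d f) P'"
  proof -
    have "D j (d f) x = 0" if "(x, Suc j) \<in> P" for x j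
      using zero_set_D[OF P(1) that order_refl] by (simp add: D_Suc)
    then show ?thesis
      using finQ Y(1,5) P(1) by (auto simp: zero_set_def P'_def Q_def D_0)
  qed
  moreover have "fst ` P' \<subseteq> {l..r}"
  proof -
    have "l \<le> Min Z" "Max Z \<le> r" using ZZ fin by auto
    then show ?thesis using QZ ZZ Y(4) by (fastforce simp: P'_def)
  qed
  moreover have "2 \<le> card (fst ` P')" if "3 \<le> card P" "2 \<le> card Z"
  proof (cases "Q = {}")
    case True
    then have "2 \<le> card Y" using cP that Y(2) by simp
    moreover have "fst ` P' = Y" using True by (force simp: P'_def)
    ultimately show ?thesis by simp
  next
    case False
    then obtain q where q: "q \<in> fst ` Q" by auto
    have "Y \<noteq> {}" using that Y(2) by auto
    then obtain y where y: "y \<in> Y" by auto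
    have "{q, y} \<subseteq> fst ` P'" using q y by (force simp: P'_def)
    moreover have "q \<noteq> y" using q y QZ Y(3) by auto
    moreover have "finite (fst ` P')" using finQ Y(1) by (simp add: P'_def)
    ultimately show ?thesis using card_mono[of "fst ` P'" "{q, y}"] by simp
  qed
  moreover have "\<forall>(x, j) \<in> P'. j = 0 \<or> (x, Suc j) \<in> P" by (auto simp: P'_def Q_def)
  ultimately show ?thesis using cP' unfolding Z_def[symmetric] by blast
qed

section \<open>Reduction of order\<close>

text \<open>
  For each \<open>n \<le> k\<close>, no nontrivial combination of \<open>w 0, \<dots>, w (n - 1)\<close> vanishes to order \<open>n\<close> at any
  point. This says that the Wronskians of \<open>w 0, \<dots>, w (n - 1)\<close>, \<open>n = 1, \<dots>, k\<close>, have no zeros in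
  \<open>[a, b]\<close>.
\<close>

definition nondegenerate :: "nat \<Rightarrow> (nat \<Rightarrow> real \<Rightarrow> real) \<Rightarrow> bool" where
  "nondegenerate k w \<longleftrightarrow> (\<forall>n\<le>k. \<forall>\<xi>\<in>{a..b}. \<forall>c.
    (\<forall>j<n. D j (\<lambda>x. \<Sum>i<n. c i * w i x) \<xi> = 0) \<longrightarrow> (\<forall>i<n. c i = 0))"

lemma nondegenerateD:
  assumes "nondegenerate k w" "n \<le> k" "\<xi> \<in> {a..b}"
    "\<And>j. j < n \<Longrightarrow> D j (\<lambda>x. \<Sum>i<n. c i * w i x) \<xi> = 0" "i < n"
  shows "c i = 0"
  using assms unfolding nondegenerate_def by blast

lemma nondegenerate_nonzero:
  assumes "nondegenerate k w" "1 \<le> k" "x \<in> {a..b}"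
  shows "w 0 x \<noteq> 0"
  using nondegenerateD[OF assms, of "\<lambda>_. 1" 0] by (auto simp: D_0)

text \<open>
  Undoing one reduction step: if \<open>(f/v)'\<close> vanishes to order \<open>n\<close> at \<open>\<xi>\<close>, then \<open>f/v - C\<close> vanishes to
  order \<open>n + 1\<close> for the constant \<open>C = f(\<xi>)/v(\<xi>)\<close>, and so does its product with \<open>v\<close>.
\<close>

lemma lift_vanishing:
  assumes k: "1 \<le> k" and v: "v \<in> D_class k a b" "\<And>x. x \<in> {a..b} \<Longrightarrow> v x \<noteq> 0"
    and f: "f \<in> D_class k a b" and n: "adm k n \<xi>"
    and van: "\<And>j. j < n \<Longrightarrow> D j (d (\<lambda>x. f x / v x)) \<xi> = 0"
  shows "\<exists>C. \<forall>j\<le>n. D j (\<lambda>x. f x - C * v x) \<xi> = 0"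
proof -
  define g where "g = (\<lambda>x. f x / v x)"
  define h where "h = (\<lambda>x. (-1) * g \<xi> + g x)"
  have xi: "\<xi> \<in> {a..b}" using n by auto
  have adm: "adm k j \<xi>" if "j \<le> n" for j using that n by (auto simp: le_less)
  have g: "g \<in> D_class k a b" unfolding g_def using k f v by (intro D_class_divide) auto
  then have h: "h \<in> D_class k a b" unfolding h_def using k
    by (intro D_class_axpy D_class_const) auto
  have hvan: "D j h \<xi> = 0" if "j \<le> n" for j
  proof -
    have "D j h \<xi> = (-1) * D j (\<lambda>_. g \<xi>) \<xi> + D j g \<xi>"
      unfolding h_def using k g adm[OF that] D_class_const by (intro D_axpy) auto
    also have "\<dots> = 0"
    proof (cases j)
      case 0
      then show ?thesis by (simp add: D_0)
    next
      case (Suc j')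
      then show ?thesis using van[of j'] that D_const[OF xi, of j "g \<xi>"]
        by (simp add: D_Suc[of j' g]) (simp add: g_def)
    qed
    finally show ?thesis .
  qed
  have "D j (\<lambda>x. f x - g \<xi> * v x) \<xi> = 0" if "j \<le> n" for j
  proof -
    have "D j (\<lambda>x. f x - g \<xi> * v x) \<xi> = D j (\<lambda>x. h x * v x) \<xi>"
      using xi v(2) by (intro D_cong) (auto simp: h_def g_def field_simps)
    also have "\<dots> = 0"
      using that hvan by (intro D_mult_vanish[OF k h v(1) adm[OF that]]) auto
    finally show ?thesis .
  qed
  then show ?thesis by blast
qed

lemma D_deriv_quotient_sum:
  fixes n :: nat
  assumes k: "1 \<le> k" and v: "v \<in> D_class (Suc k) a b" "\<And>x. x \<in> {a..b} \<Longrightarrow> v x \<noteq> 0"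
    and w: "\<And>i. i < n \<Longrightarrow> w i \<in> D_class (Suc k) a b" and x: "x \<in> {a..b}"
  shows "(\<Sum>i<n. c i * d (\<lambda>x. w i x / v x) x) = d (\<lambda>x. (\<Sum>i<n. c i * w i x) / v x) x"
proof -
  have "D 1 (\<lambda>x. \<Sum>i<n. c i * (w i x / v x)) x = (\<Sum>i<n. c i * D 1 (\<lambda>x. w i x / v x) x)"
    using k v w x by (intro D_sum[of "Suc k"] D_class_divide) auto
  then show ?thesis by (simp add: D_Suc D_0 sum_divide_distrib)
qed

lemma deriv_quotient_D_class:
  assumes k: "1 \<le> k" and v: "v \<in> D_class (Suc k) a b" "\<And>x. x \<in> {a..b} \<Longrightarrow> v x \<noteq> 0"
    and f: "f \<in> D_class (Suc k) a b"
  shows "d (\<lambda>x. f x / v x) \<in> D_class k a b"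
  using D_class_divide[OF _ f v] D_class_Suc[OF k] by auto

lemma nondegenerate_deriv_quotient:
  assumes k: "1 \<le> k" and w: "\<And>i. i < Suc k \<Longrightarrow> w i \<in> D_class (Suc k) a b"
    and nd: "nondegenerate (Suc k) w"
  shows "nondegenerate k (\<lambda>i. d (\<lambda>x. w (Suc i) x / w 0 x))"
  unfolding nondegenerate_def
proof (intro allI ballI impI)
  fix n \<xi> c i
  assume n: "n \<le> k" "i < n" and xi: "\<xi> \<in> {a..b}"
    and van: "\<forall>j<n. D j (\<lambda>x. \<Sum>i<n. c i * d (\<lambda>x. w (Suc i) x / w 0 x) x) \<xi> = 0"
  have nz: "w 0 x \<noteq> 0" if "x \<in> {a..b}" for x using nondegenerate_nonzero[OF nd _ that] by simp
  have eq: "D j (\<lambda>x. \<Sum>i<n. c i * d (\<lambda>x. w (Suc i) x / w 0 x) x) \<xi> =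
      D j (d (\<lambda>x. (\<Sum>i<n. c i * w (Suc i) x) / w 0 x)) \<xi>" for j
    using w n nz xi by (intro D_cong D_deriv_quotient_sum[OF k]) auto
  obtain C where C: "\<forall>j\<le>n. D j (\<lambda>x. (\<Sum>i<n. c i * w (Suc i) x) - C * w 0 x) \<xi> = 0"
    using lift_vanishing[of "Suc k" "w 0" "\<lambda>x. \<Sum>i<n. c i * w (Suc i) x" n \<xi>] w nz n xi van eq
      D_class_sum[of "Suc k" n "\<lambda>i. w (Suc i)"] by auto
  define c' where "c' = (\<lambda>i. case i of 0 \<Rightarrow> - C | Suc i \<Rightarrow> c i)"
  have "c' (Suc i) = 0"
  proof (rule nondegenerateD[OF nd _ xi])
    fix j assume "j < Suc n"
    then have "D j (\<lambda>x. (\<Sum>i<n. c i * w (Suc i) x) - C * w 0 x) \<xi> = 0" using C by auto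
    then show "D j (\<lambda>x. \<Sum>i<Suc n. c' i * w i x) \<xi> = 0"
      by (simp add: sum.lessThan_Suc_shift c'_def del: sum.lessThan_Suc)
  qed (use n in auto)
  then show "c i = 0" by (simp add: c'_def)
qed

lemma zero_set_mult:
  assumes "1 \<le> k" "f \<in> D_class k a b" "g \<in> D_class k a b" "zero_set f P"
    "P \<subseteq> {a..b} \<times> {..<k}"
  shows "zero_set (\<lambda>x. f x * g x) P"
proof -
  have "D j (\<lambda>x. f x * g x) x = 0" if "(x, j) \<in> P" for x j
    using that assms zero_set_D[OF assms(4) that] by (intro D_mult_vanish[of k f g]) auto
  then show ?thesis using assms(4) by (auto simp: zero_set_def)
qed

lemma zero_set_deriv_quotient:
  assumes k: "1 \<le> k" and v: "v \<in> D_class (Suc k) a b" "\<And>x. x \<in> {a..b} \<Longrightarrow> v x \<noteq> 0"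
    and f: "f \<in> D_class (Suc k) a b" and P: "zero_set f P" "P \<noteq> {}"
    and lr: "P \<subseteq> {l..r} \<times> {..<Suc k}" "{l..r} \<subseteq> {a..b}"
  shows "\<exists>P'. zero_set (d (\<lambda>x. f x / v x)) P' \<and> Suc (card P') = card P \<and>
    P' \<subseteq> {l..r} \<times> {..<k} \<and>
    (3 \<le> card P \<longrightarrow> 2 \<le> card (fst ` P) \<longrightarrow> 2 \<le> card (fst ` P'))"
proof -
  have "zero_set (\<lambda>x. f x / v x) P"
    unfolding divide_inverse using f v lr P
    by (intro zero_set_mult[of "Suc k"] D_class_inverse) auto
  moreover have "(\<lambda>x. f x / v x) \<in> D_class (Suc 0) a b"
    using D_class_divide[OF _ f v] D_class_imp_D_class_1 by auto
  moreover have "fst ` P \<subseteq> {l..r}" using lr by auto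
  ultimately obtain P' where P': "zero_set (d (\<lambda>x. f x / v x)) P'" "Suc (card P') = card P"
    "fst ` P' \<subseteq> {l..r}" "\<forall>(x, j) \<in> P'. j = 0 \<or> (x, Suc j) \<in> P"
    "3 \<le> card P \<longrightarrow> 2 \<le> card (fst ` P) \<longrightarrow> 2 \<le> card (fst ` P')"
    using rolle_multiplicities[of "\<lambda>x. f x / v x" P l r] P(2) lr(2) by auto
  have "P' \<subseteq> {l..r} \<times> {..<k}"
  proof (rule subsetI)
    fix p assume p: "p \<in> P'"
    obtain x j where xj: "p = (x, j)" by (cases p)
    have "x \<in> {l..r}" using p P'(3) by (auto simp: xj)
    moreover have "j = 0 \<or> (x, Suc j) \<in> P" using p P'(4) by (auto simp: xj)
    then have "j < k" using lr(1) k by auto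
    ultimately show "p \<in> {l..r} \<times> {..<k}" by (simp add: xj)
  qed
  with P'(1,2,5) show ?thesis by (intro exI[of _ P'] conjI)
qed

text \<open>
  A nontrivial combination of a nondegenerate family of \<open>k\<close> functions cannot have \<open>k\<close> zeros,
  counted with multiplicity. Unlike in \<open>nondegenerate\<close>, the zeros may be at different points.
\<close>

lemma chebyshev_system:
  assumes "1 \<le> k" "\<And>i. i < k \<Longrightarrow> w i \<in> D_class k a b" "nondegenerate k w"
    "zero_set (\<lambda>x. \<Sum>i<k. c i * w i x) P" "P \<subseteq> {a..b} \<times> {..<k}" "k \<le> card P" "i < k"
  shows "c i = 0"
  using assms
proof (induction k arbitrary: w c P i rule: nat_induct_at_least)
  case base
  have "P \<noteq> {}" using base(5) by auto
  then obtain x j where x: "(x, j) \<in> P" by (metis ex_in_conv prod.collapse)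
  then have "x \<in> {a..b}" using base(4) by auto
  then have "w 0 x \<noteq> 0" by (rule nondegenerate_nonzero[OF base(2) order_refl])
  then show ?case using zero_set_D[OF base(3) x, of 0] base(6) by (simp add: D_0)
next
  case (Suc k)
  have P: "P \<noteq> {}" using Suc.prems(5) by auto
  have nz: "w 0 x \<noteq> 0" if "x \<in> {a..b}" for x
    using nondegenerate_nonzero[OF Suc.prems(2) _ that] by simp
  have w0: "w 0 \<in> D_class (Suc k) a b" using Suc.prems(1) by simp
  define f where "f = (\<lambda>x. \<Sum>i<Suc k. c i * w i x)"
  have fP: "zero_set f P" using Suc.prems(3) by (simp add: f_def)
  have f: "f \<in> D_class (Suc k) a b"
    unfolding f_def using Suc.prems(1) by (intro D_class_sum) auto
  obtain P' where P': "zero_set (d (\<lambda>x. f x / w 0 x)) P'" "Suc (card P') = card P"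
    "P' \<subseteq> {a..b} \<times> {..<k}"
    using zero_set_deriv_quotient[OF Suc.hyps w0 nz f fP P Suc.prems(4)] by auto
  have eq: "d (\<lambda>x. f x / w 0 x) y = (\<Sum>i<k. c (Suc i) * d (\<lambda>x. w (Suc i) x / w 0 x) y)"
    if y: "y \<in> {a..b}" for y
  proof -
    have "d (\<lambda>x. f x / w 0 x) y =
        d (\<lambda>x. c 0 * 1 + (\<Sum>i<k. c (Suc i) * (w (Suc i) x / w 0 x))) y"
      using y nz by (intro d_cong)
        (auto simp: f_def sum.lessThan_Suc_shift add_divide_distrib sum_divide_distrib
          simp del: sum.lessThan_Suc)
    also have "\<dots> = D 1 (\<lambda>x. c 0 * 1 + (\<Sum>i<k. c (Suc i) * (w (Suc i) x / w 0 x))) y"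
      by (simp add: D_Suc D_0)
    also have "\<dots> = c 0 * D 1 (\<lambda>_. 1) y + D 1 (\<lambda>x. \<Sum>i<k. c (Suc i) * (w (Suc i) x / w 0 x)) y"
      using y Suc.hyps Suc.prems(1) nz
      by (intro D_axpy[of "Suc k"] D_class_const D_class_sum D_class_divide) auto
    also have "D 1 (\<lambda>x. \<Sum>i<k. c (Suc i) * (w (Suc i) x / w 0 x)) y =
        (\<Sum>i<k. c (Suc i) * D 1 (\<lambda>x. w (Suc i) x / w 0 x) y)"
      using y Suc.hyps Suc.prems(1) nz by (intro D_sum[of "Suc k"] D_class_divide) auto
    finally show ?thesis using y by (simp add: D_const) (simp add: D_Suc D_0)
  qed
  have "zero_set (\<lambda>x. \<Sum>i<k. c (Suc i) * d (\<lambda>x. w (Suc i) x / w 0 x) x) P'"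
  proof -
    have "D j (\<lambda>x. \<Sum>i<k. c (Suc i) * d (\<lambda>x. w (Suc i) x / w 0 x) x) x =
        D j (d (\<lambda>x. f x / w 0 x)) x" if "(x, j) \<in> P'" for x j
      using that P'(3) eq by (intro D_cong) auto
    then show ?thesis using P'(1) by (auto simp: zero_set_def)
  qed
  moreover have "d (\<lambda>x. w (Suc i) x / w 0 x) \<in> D_class k a b" if "i < k" for i
    using that Suc.prems(1) nz by (intro deriv_quotient_D_class[OF Suc.hyps]) auto
  moreover have "k \<le> card P'" using P'(2) Suc.prems(5) by simp
  ultimately have c: "c (Suc i) = 0" if "i < k" for i
    using Suc.IH[OF _ nondegenerate_deriv_quotient[OF Suc.hyps Suc.prems(1,2)], of "\<lambda>i. c (Suc i)" P' i]
      P'(3) that by simp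
  have "c 0 = 0"
  proof -
    obtain x j where x: "(x, j) \<in> P" using P by (metis ex_in_conv prod.collapse)
    then have "w 0 x \<noteq> 0" using Suc.prems(4) nz by blast
    moreover have "f x = c 0 * w 0 x"
      using c by (simp add: f_def sum.lessThan_Suc_shift del: sum.lessThan_Suc)
    ultimately show ?thesis using zero_set_D[OF fP x, of 0] by (simp add: D_0)
  qed
  then show ?case using c Suc.prems(6) by (cases i) auto
qed

text \<open>
  The Wronskian of a nondegenerate family extended by \<open>f\<close> vanishes at some point \<open>\<xi>\<close> once \<open>f\<close> has \<open>k + 1\<close> zeros that are not all at one point. Each step of the induction
  replaces \<open>f\<close> by \<open>(f/w 0)'\<close>; in the last one two distinct zeros remain, and Rolle's theorem
  puts \<open>\<xi>\<close> strictly between them.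
\<close>

lemma osculating_combination:
  assumes "1 \<le> k" "\<And>i. i < k \<Longrightarrow> w i \<in> D_class k a b" "nondegenerate k w"
    "f \<in> D_class k a b" "zero_set f P" "P \<subseteq> {l..r} \<times> {..<k}" "{l..r} \<subseteq> {a..b}"
    "card P = Suc k" "2 \<le> card (fst ` P)"
  shows "\<exists>\<xi>\<in>{l<..<r}. \<exists>e. \<forall>j\<le>k. D j (\<lambda>x. f x - (\<Sum>i<k. e i * w i x)) \<xi> = 0"
  using assms
proof (induction k arbitrary: w f P rule: nat_induct_at_least)
  case base
  have nz: "w 0 x \<noteq> 0" if "x \<in> {a..b}" for x
    using nondegenerate_nonzero[OF base(2) _ that] by simp
  have w0: "w 0 \<in> D_class 1 a b" using base by simp
  define g where "g = (\<lambda>x. f x / w 0 x)"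
  have g: "g \<in> D_class (Suc 0) a b"
    using D_class_divide[OF _ base(3) w0 nz] by (simp add: g_def)
  define Z where "Z = fst ` P"
  have fin: "finite Z" using base(4) by (simp add: Z_def zero_set_def)
  have Zlr: "Z \<subseteq> {l..r}" using base(5) by (auto simp: Z_def)
  have Z2: "2 \<le> card Z" using base(8) by (simp add: Z_def)
  have "g z = 0" if "z \<in> Z" for z
    using that zero_set_D[OF base(4), of z _ 0] by (auto simp: Z_def g_def D_0)
  then obtain Y where Y: "Suc (card Y) = card Z" "Y \<subseteq> {Min Z<..<Max Z}" "\<forall>y\<in>Y. d g y = 0"
    using rolle_points[OF g fin] Z2 Zlr base(6) by fastforce
  have "Y \<noteq> {}" using Y(1) Z2 by auto
  then obtain y where y: "y \<in> {Min Z<..<Max Z}" "d g y = 0" using Y(2,3) by blast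
  have "Z \<noteq> {}" using Z2 by auto
  then have "Min Z \<in> Z" "Max Z \<in> Z" using fin by auto
  then have "l \<le> Min Z" "Max Z \<le> r" "Min Z \<in> {a..b}" "Max Z \<in> {a..b}"
    using Zlr base(6) by (meson atLeastAtMost_iff subsetD)+
  then have yy: "y \<in> {l<..<r}" "y \<in> {a<..<b}" using y(1) by auto
  then obtain C where C: "\<forall>j\<le>1. D j (\<lambda>x. f x - C * w 0 x) y = 0"
    using lift_vanishing[OF _ w0 nz base(3), of 1 y] y(2) by (auto simp: D_0 g_def)
  show ?case
    by (rule bexI[OF _ yy(1)], rule exI[of _ "\<lambda>_. C"]) (use C in simp)
next
  case (Suc k)
  have P: "P \<noteq> {}" using Suc.prems(7) by auto
  have nz: "w 0 x \<noteq> 0" if "x \<in> {a..b}" for x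
    using nondegenerate_nonzero[OF Suc.prems(2) _ that] by simp
  have w0: "w 0 \<in> D_class (Suc k) a b" using Suc.prems(1) by simp
  let ?w = "\<lambda>i. d (\<lambda>x. w (Suc i) x / w 0 x)"
  obtain P' where P': "zero_set (d (\<lambda>x. f x / w 0 x)) P'" "Suc (card P') = card P"
    "P' \<subseteq> {l..r} \<times> {..<k}" "2 \<le> card (fst ` P')"
    using zero_set_deriv_quotient[OF Suc.hyps w0 nz Suc.prems(3,4) P Suc.prems(5,6)]
      Suc.prems(7,8) Suc.hyps by auto
  have w': "?w i \<in> D_class k a b" if "i < k" for i
    using that Suc.prems(1) by (intro deriv_quotient_D_class[OF Suc.hyps w0 nz]) auto
  have "card P' = Suc k" using P'(2) Suc.prems(7) by simp
  then obtain \<xi> e where xi: "\<xi> \<in> {l<..<r}"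
    and e: "\<forall>j\<le>k. D j (\<lambda>x. d (\<lambda>x. f x / w 0 x) x - (\<Sum>i<k. e i * ?w i x)) \<xi> = 0"
    using Suc.IH[OF w' nondegenerate_deriv_quotient[OF Suc.hyps Suc.prems(1,2)]
        deriv_quotient_D_class[OF Suc.hyps w0 nz Suc.prems(3)] P'(1,3) Suc.prems(6) _ P'(4)]
    by auto
  have xi': "\<xi> \<in> {a<..<b}" using xi Suc.prems(6) by (auto simp: subset_iff intro: le_less_trans less_le_trans)
  define g where "g = (\<lambda>x. -1 * (\<Sum>i<k. e i * w (Suc i) x) + f x)"
  have S: "(\<lambda>x. \<Sum>i<k. e i * w (Suc i) x) \<in> D_class (Suc k) a b"
    using Suc.prems(1) by (intro D_class_sum) auto
  have g: "g \<in> D_class (Suc k) a b"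
    unfolding g_def using S Suc.prems(3) by (intro D_class_axpy) auto
  have eq: "d (\<lambda>x. f x / w 0 x) y - (\<Sum>i<k. e i * ?w i y) = d (\<lambda>x. g x / w 0 x) y"
    if y: "y \<in> {a..b}" for y
  proof -
    have "d (\<lambda>x. g x / w 0 x) y =
        D 1 (\<lambda>x. -1 * ((\<Sum>i<k. e i * w (Suc i) x) / w 0 x) + f x / w 0 x) y"
      by (simp add: g_def D_Suc D_0 diff_divide_distrib)
    also have "\<dots> = -1 * D 1 (\<lambda>x. (\<Sum>i<k. e i * w (Suc i) x) / w 0 x) y + D 1 (\<lambda>x. f x / w 0 x) y"
      using Suc.hyps S w0 nz Suc.prems(3) y by (intro D_axpy[of "Suc k"] D_class_divide) auto
    also have "D 1 (\<lambda>x. (\<Sum>i<k. e i * w (Suc i) x) / w 0 x) y = (\<Sum>i<k. e i * ?w i y)"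
      using D_deriv_quotient_sum[OF Suc.hyps w0 nz, of k "\<lambda>i. w (Suc i)" y e] Suc.prems(1) y
      by (simp add: D_Suc D_0)
    finally show ?thesis by (simp add: D_Suc D_0)
  qed
  have "D j (d (\<lambda>x. g x / w 0 x)) \<xi> = 0" if "j < Suc k" for j
  proof -
    have "D j (d (\<lambda>x. g x / w 0 x)) \<xi> = D j (\<lambda>x. d (\<lambda>x. f x / w 0 x) x - (\<Sum>i<k. e i * ?w i x)) \<xi>"
      using xi' eq by (intro D_cong) auto
    then show ?thesis using e that by simp
  qed
  then obtain C where C: "\<forall>j\<le>Suc k. D j (\<lambda>x. g x - C * w 0 x) \<xi> = 0"
    using lift_vanishing[OF _ w0 nz g, of "Suc k" \<xi>] xi' by auto
  define e' where "e' = (\<lambda>i. case i of 0 \<Rightarrow> C | Suc i \<Rightarrow> e i)"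
  have "(\<lambda>x. g x - C * w 0 x) = (\<lambda>x. f x - (\<Sum>i<Suc k. e' i * w i x))"
    by (simp add: g_def e'_def sum.lessThan_Suc_shift algebra_simps del: sum.lessThan_Suc)
  then have "\<forall>j\<le>Suc k. D j (\<lambda>x. f x - (\<Sum>i<Suc k. e' i * w i x)) \<xi> = 0" using C by simp
  then show ?case using xi by blast
qed

section \<open>Rolle's theorem for determinants\<close>

lemma D_class_reduced:
  fixes m :: nat
  assumes "1 \<le> k" "f \<in> D_class k a b" "\<And>t. t < m \<Longrightarrow> g t \<in> D_class k a b"
  shows "(\<lambda>x. f x - (\<Sum>t<m. \<beta> t * g t x)) \<in> D_class k a b"
proof -
  have "(\<lambda>x. -1 * (\<Sum>t<m. \<beta> t * g t x) + f x) \<in> D_class k a b"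
    using assms by (intro D_class_axpy D_class_sum) auto
  then show ?thesis by simp
qed

lemma D_reduced:
  fixes m :: nat
  assumes "1 \<le> k" "f \<in> D_class k a b" "\<And>t. t < m \<Longrightarrow> g t \<in> D_class k a b" "adm k j x"
  shows "D j (\<lambda>x. f x - (\<Sum>t<m. \<beta> t * g t x)) x = D j f x - (\<Sum>t<m. \<beta> t * D j (g t) x)"
proof -
  have "D j (\<lambda>x. -1 * (\<Sum>t<m. \<beta> t * g t x) + f x) x =
      -1 * D j (\<lambda>x. \<Sum>t<m. \<beta> t * g t x) x + D j f x"
    using assms by (intro D_axpy D_class_sum) auto
  also have "D j (\<lambda>x. \<Sum>t<m. \<beta> t * g t x) x = (\<Sum>t<m. \<beta> t * D j (g t) x)"
    using assms by (intro D_sum) auto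
  finally show ?thesis by simp
qed

lemma W_det_eq_0_iff_reduced:
  assumes k: "1 \<le> k" and len: "length \<omega>s = m + l" "length vs = m + l" "length xs = l"
    and det: "m > 0 \<longrightarrow> Determinant.det (mat_of_rows m (take m vs)) \<noteq> 0"
    and \<omega>: "set \<omega>s \<subseteq> D_class k a b"
    and nodes: "\<And>x j. (x, j) \<in> set (confluent_nodes xs) \<Longrightarrow> adm k j x"
    and rel: "\<And>i j. i < l \<Longrightarrow> j < m \<Longrightarrow>
      vec_index (vs ! (m + i)) j = (\<Sum>t<m. \<alpha> i t * vec_index (vs ! t) j)"
    and w: "\<And>i. i < l \<Longrightarrow> w i = (\<lambda>x. (\<omega>s ! (m + i)) x - (\<Sum>t<m. \<alpha> i t * (\<omega>s ! t) x))"
  shows "W_det {a..b} m \<omega>s vs xs = 0 \<longleftrightarrow> (\<exists>e. (\<exists>i<l. e i \<noteq> 0) \<and>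
    (\<forall>(x, j)\<in>set (confluent_nodes xs). D j (\<lambda>x. \<Sum>i<l. e i * w i x) x = 0))"
proof -
  have \<omega>': "\<omega>s ! i \<in> D_class k a b" if "i < m + l" for i
    using \<omega> len(1) that by (auto simp: subset_iff)
  have w': "w i \<in> D_class k a b" if "i < l" for i
    unfolding w[OF that] using that \<omega>' k by (intro D_class_reduced) auto
  have D_w: "D j (\<lambda>x. \<Sum>i<l. e i * w i x) x =
      (\<Sum>i<l. e i * (D j (\<omega>s ! (m + i)) x - (\<Sum>t<m. \<alpha> i t * D j (\<omega>s ! t) x)))"
    if "adm k j x" for e j x
  proof -
    have "D j (w i) x = D j (\<omega>s ! (m + i)) x - (\<Sum>t<m. \<alpha> i t * D j (\<omega>s ! t) x)" if "i < l" for i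
      unfolding w[OF that] using that \<omega>' k \<open>adm k j x\<close> by (intro D_reduced) auto
    then show ?thesis using D_sum[OF k w' that] by simp
  qed
  have "W_det {a..b} m \<omega>s vs xs = 0 \<longleftrightarrow> (\<exists>e. (\<exists>i<l. e i \<noteq> 0) \<and>
    (\<forall>p\<in>set (confluent_nodes xs). (\<Sum>i<l. e i * (D (snd p) (\<omega>s ! (m + i)) (fst p) -
       (\<Sum>t<m. \<alpha> i t * D (snd p) (\<omega>s ! t) (fst p)))) = 0))"
    unfolding W_det_eq_0_iff[OF len(3)]
  proof (rule eliminate_vectors[where u = "\<lambda>i. vec_index (vs ! i)"])
    show "c t = 0" if "\<And>j. j < m \<Longrightarrow> (\<Sum>t<m. c t * vec_index (vs ! t) j) = 0" "t < m" for c t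
      by (rule rows_independent[OF det _ that]) (simp add: len)
  qed (rule rel)
  also have "\<dots> \<longleftrightarrow> (\<exists>e. (\<exists>i<l. e i \<noteq> 0) \<and>
    (\<forall>(x, j)\<in>set (confluent_nodes xs). D j (\<lambda>x. \<Sum>i<l. e i * w i x) x = 0))"
    using D_w nodes by (auto simp: case_prod_beta)
  finally show ?thesis .
qed

lemma W_det_rolle:
  assumes k: "1 \<le> k" and us: "length us = m + k" and ws: "length ws = m + k"
    and det: "m > 0 \<longrightarrow> Determinant.det (mat_of_rows m (take m us)) \<noteq> 0"
    and D: "set ws \<subseteq> D_class k a b"
    and W: "\<And>n \<xi>. n \<in> {1..k} \<Longrightarrow> \<xi> \<in> {a..b} \<Longrightarrow>
      W_det {a..b} m (take (m + n) ws) (take (m + n) us) (replicate n \<xi>) \<noteq> 0"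
    and xs: "length xs = Suc k" "set xs \<subseteq> {a..b}" "Min (set xs) < Max (set xs)"
    and h: "h \<in> D_class k a b"
    and zero: "W_det {a..b} m (ws @ [h]) (us @ [r]) xs = 0"
  shows "\<exists>\<xi>. Min (set xs) < \<xi> \<and> \<xi> < Max (set xs) \<and>
    W_det {a..b} m (ws @ [h]) (us @ [r]) (replicate (Suc k) \<xi>) = 0"
proof -
  define \<omega>s where "\<omega>s = ws @ [h]"
  define vs where "vs = us @ [r]"
  have len: "length \<omega>s = m + Suc k" "length vs = m + Suc k" using us ws by (auto simp: \<omega>s_def vs_def)
  have \<omega>: "set \<omega>s \<subseteq> D_class k a b" using D h by (simp add: \<omega>s_def)
  have det': "m > 0 \<longrightarrow> Determinant.det (mat_of_rows m (take m vs)) \<noteq> 0"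
    using det us by (simp add: vs_def)
  have "\<forall>i. \<exists>\<alpha>. \<forall>j<m. vec_index (vs ! (m + i)) j = (\<Sum>t<m. \<alpha> t * vec_index (vs ! t) j)"
    using rows_span[OF det'] len by simp
  then obtain \<alpha> where \<alpha>: "\<And>i j. j < m \<Longrightarrow>
      vec_index (vs ! (m + i)) j = (\<Sum>t<m. \<alpha> i t * vec_index (vs ! t) j)"
    by metis
  define w where "w i = (\<lambda>x. (\<omega>s ! (m + i)) x - (\<Sum>t<m. \<alpha> i t * (\<omega>s ! t) x))" for i
  have w: "w i \<in> D_class k a b" if "i < Suc k" for i
    unfolding w_def using that \<omega> len(1) k by (intro D_class_reduced) (auto simp: subset_iff)
  have nd: "nondegenerate k w"
    unfolding nondegenerate_def
  proof (intro allI ballI impI)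
    fix n \<xi> c i
    assume n: "n \<le> k" "i < n" and xi: "\<xi> \<in> {a..b}"
      and van: "\<forall>j<n. D j (\<lambda>x. \<Sum>i<n. c i * w i x) \<xi> = 0"
    have take: "take (m + n) ws = take (m + n) \<omega>s" "take (m + n) us = take (m + n) vs"
      using n us ws by (auto simp: \<omega>s_def vs_def)
    have "W_det {a..b} m (take (m + n) \<omega>s) (take (m + n) vs) (replicate n \<xi>) = 0 \<longleftrightarrow>
      (\<exists>e. (\<exists>i<n. e i \<noteq> 0) \<and> (\<forall>(x, j)\<in>set (confluent_nodes (replicate n \<xi>)).
        D j (\<lambda>x. \<Sum>i<n. e i * w i x) x = 0))"
    proof (rule W_det_eq_0_iff_reduced[OF k])
      show "set (take (m + n) \<omega>s) \<subseteq> D_class k a b" using \<omega> set_take_subset by fast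
      show "0 < m \<longrightarrow> Determinant.det (mat_of_rows m (take m (take (m + n) vs))) \<noteq> 0"
        using det' by (simp add: min_def)
      show "adm k j x" if "(x, j) \<in> set (confluent_nodes (replicate n \<xi>))" for x j
        using that n xi by (auto simp: set_confluent_nodes_replicate)
    qed (use n len \<alpha> in \<open>auto simp: w_def\<close>)
    moreover have "W_det {a..b} m (take (m + n) \<omega>s) (take (m + n) vs) (replicate n \<xi>) \<noteq> 0"
      using W[of n \<xi>] n xi unfolding take by auto
    ultimately show "c i = 0" using van n(2) by (auto simp: set_confluent_nodes_replicate)
  qed
  define P where "P = set (confluent_nodes xs)"
  have P: "P = Sigma (set xs) (\<lambda>x. {..<count_list xs x})" "card P = Suc k"
    using xs(1) by (simp add: P_def set_confluent_nodes) (simp add: P_def card_confluent_nodes xs(1))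
  have Pk: "j < k" "x \<in> set xs" if "(x, j) \<in> P" for x j
    using confluent_nodes_order_less[OF xs(3), of x j] that xs(1)
    by (auto simp: P_def set_confluent_nodes)
  have "\<exists>e. (\<exists>i<Suc k. e i \<noteq> 0) \<and>
      (\<forall>(x, j)\<in>set (confluent_nodes xs). D j (\<lambda>x. \<Sum>i<Suc k. e i * w i x) x = 0)"
  proof (rule W_det_eq_0_iff_reduced[OF k len xs(1) det' \<omega>, THEN iffD1])
    show "adm k j x" if "(x, j) \<in> set (confluent_nodes xs)" for x j
      using Pk[of x j] that xs(2) by (auto simp: P_def)
  qed (use \<alpha> zero in \<open>auto simp: w_def \<omega>s_def vs_def\<close>)
  then obtain e where e: "\<exists>i<Suc k. e i \<noteq> 0"
    "\<And>x j. (x, j) \<in> P \<Longrightarrow> D j (\<lambda>x. \<Sum>i<Suc k. e i * w i x) x = 0"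
    unfolding P_def by blast
  define \<phi> where "\<phi> = (\<lambda>x. \<Sum>i<Suc k. e i * w i x)"
  have \<phi>: "\<phi> \<in> D_class k a b" unfolding \<phi>_def using w k by (intro D_class_sum) auto
  have zs: "zero_set \<phi> P"
    using e(2) by (auto simp: zero_set_def \<phi>_def P(1))
  \<comment> \<open>\<open>w k\<close> is the reduction of \<open>h\<close>; without it, \<open>\<phi>\<close> would contradict the Chebyshev property.\<close>
  have ek: "e k \<noteq> 0"
  proof
    assume "e k = 0"
    then have "zero_set (\<lambda>x. \<Sum>i<k. e i * w i x) P" using zs by (simp add: \<phi>_def)
    moreover have "P \<subseteq> {a..b} \<times> {..<k}" using Pk xs(2) by auto
    ultimately have "e i = 0" if "i < k" for i
      using chebyshev_system[OF k _ nd _ _ _ that, of e P] w P(2) by simp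
    then show False using e(1) \<open>e k = 0\<close> by (auto simp: less_Suc_eq)
  qed
  let ?l = "Min (set xs)" and ?r = "Max (set xs)"
  have ne: "set xs \<noteq> {}" using xs(1) by auto
  have lr: "?l \<in> set xs" "?r \<in> set xs" using ne by auto
  have fstP: "fst ` P = set xs"
    by (force simp: P(1) count_list_0_iff image_iff intro: gr0I)
  have "\<exists>\<xi>\<in>{?l<..<?r}. \<exists>e'. \<forall>j\<le>k. D j (\<lambda>x. \<phi> x - (\<Sum>i<k. e' i * w i x)) \<xi> = 0"
  proof (rule osculating_combination[OF k _ nd \<phi> zs])
    show "P \<subseteq> {?l..?r} \<times> {..<k}" using Pk by auto
    show "{?l..?r} \<subseteq> {a..b}" using lr xs(2) by auto
    have "card {?l, ?r} \<le> card (set xs)" using lr by (intro card_mono) auto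
    then show "2 \<le> card (fst ` P)" using xs(3) by (simp add: fstP)
  qed (use w P in auto)
  then obtain \<xi> e' where xi: "?l < \<xi>" "\<xi> < ?r"
    and e': "\<forall>j\<le>k. D j (\<lambda>x. \<phi> x - (\<Sum>i<k. e' i * w i x)) \<xi> = 0"
    by (metis greaterThanLessThan_iff)
  have xiab: "\<xi> \<in> {a<..<b}" using xi lr xs(2) by (auto simp: subset_iff intro: le_less_trans less_le_trans)
  define c where "c i = (if i < k then e i - e' i else e i)" for i
  have c: "(\<lambda>x. \<phi> x - (\<Sum>i<k. e' i * w i x)) = (\<lambda>x. \<Sum>i<Suc k. c i * w i x)"
    by (simp add: \<phi>_def c_def left_diff_distrib sum_subtractf) (simp add: algebra_simps)
  have "W_det {a..b} m \<omega>s vs (replicate (Suc k) \<xi>) = 0"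
  proof (rule W_det_eq_0_iff_reduced[OF k len _ det' \<omega>, THEN iffD2])
    show "adm k j x" if "(x, j) \<in> set (confluent_nodes (replicate (Suc k) \<xi>))" for x j
      using that xiab unfolding set_confluent_nodes_replicate by auto
    show "\<exists>e. (\<exists>i<Suc k. e i \<noteq> 0) \<and> (\<forall>(x, j)\<in>set (confluent_nodes (replicate (Suc k) \<xi>)).
        D j (\<lambda>x. \<Sum>i<Suc k. e i * w i x) x = 0)"
      using e' ek unfolding set_confluent_nodes_replicate c
      by (intro exI[of _ c]) (auto simp: c_def simp del: sum.lessThan_Suc)
  qed (use \<alpha> in \<open>auto simp: w_def\<close>)
  then show ?thesis using xi by (auto simp: \<omega>s_def vs_def)
qed

end

theorem theorem1:
  fixes a b :: real and k m :: nat
    and us :: "real Matrix.vec list" and ws :: "(real \<Rightarrow> real) list"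
  assumes "a < b" and "k \<ge> 1"
    and "length us = m + k" and "set us \<subseteq> carrier_vec m"
    and "m > 0 \<longrightarrow> Determinant.det (mat_of_rows m (take m us)) \<noteq> 0"
    and "length ws = m + k" and "set ws \<subseteq> D_class k a b"
    and "\<And>n \<xi>. n \<in> {1..k} \<Longrightarrow> \<xi> \<in> {a..b} \<Longrightarrow>
      W_det {a..b} m (take (m + n) ws) (take (m + n) us) (replicate n \<xi>) \<noteq> 0"
  shows "\<forall>xs p q f g.
    length xs = k + 1 \<and> set xs \<subseteq> {a..b} \<and> Min (set xs) < Max (set xs) \<and>
    p \<in> carrier_vec m \<and> q \<in> carrier_vec m \<and> f \<in> D_class k a b \<and> g \<in> D_class k a b \<longrightarrow>
    (\<exists>\<xi>. Min (set xs) < \<xi> \<and> \<xi> < Max (set xs) \<and>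
      W_det {a..b} m (ws @ [f]) (us @ [p]) (replicate (k + 1) \<xi>) *
      W_det {a..b} m (ws @ [g]) (us @ [q]) xs =
      W_det {a..b} m (ws @ [g]) (us @ [q]) (replicate (k + 1) \<xi>) *
      W_det {a..b} m (ws @ [f]) (us @ [p]) xs)"
proof (intro allI impI)
  fix xs :: "real list" and p q :: "real Matrix.vec" and f g :: "real \<Rightarrow> real"
  assume asm: "length xs = k + 1 \<and> set xs \<subseteq> {a..b} \<and> Min (set xs) < Max (set xs) \<and>
    p \<in> carrier_vec m \<and> q \<in> carrier_vec m \<and> f \<in> D_class k a b \<and> g \<in> D_class k a b"
  let ?W = "\<lambda>h r xs. W_det {a..b} m (ws @ [h]) (us @ [r]) xs"
  define A where "A = ?W g q xs"
  define B where "B = ?W f p xs"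
  define h where "h = (\<lambda>x. A * f x + (-B) * g x)"
  define r where "r = Matrix.vec m (\<lambda>j. A * vec_index p j + (-B) * vec_index q j)"
  have h: "h \<in> D_class k a b"
    using D_class_axpy[OF assms(1,2), of f "\<lambda>x. (-B) * g x + 0" A]
      D_class_axpy[OF assms(1,2), of g "\<lambda>_. 0" "-B"] D_class_const[OF assms(1,2)] asm
    by (simp add: h_def)
  have Dh: "nth_deriv_within {a..b} j h x =
      A * nth_deriv_within {a..b} j f x + (-B) * nth_deriv_within {a..b} j g x"
    if "j < k \<and> x \<in> {a..b} \<or> j = k \<and> x \<in> {a<..<b}" for j x
  proof -
    have g: "(\<lambda>x. (-B) * g x + 0) \<in> D_class k a b"
      using asm by (intro D_class_axpy[OF assms(1,2)] D_class_const[OF assms(1,2)]) auto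
    have "nth_deriv_within {a..b} j (\<lambda>x. A * f x + ((-B) * g x + 0)) x =
        A * nth_deriv_within {a..b} j f x + nth_deriv_within {a..b} j (\<lambda>x. (-B) * g x + 0) x"
      by (rule D_axpy[OF assms(1,2) _ g that]) (use asm in simp)
    also have "nth_deriv_within {a..b} j (\<lambda>x. (-B) * g x + 0) x =
        (-B) * nth_deriv_within {a..b} j g x + nth_deriv_within {a..b} j (\<lambda>_. 0) x"
      by (rule D_axpy[OF assms(1,2) _ D_class_const[OF assms(1,2)] that]) (use asm in simp)
    finally show ?thesis using that D_const[OF assms(1), of x j 0] by (auto simp: h_def)
  qed
  have lin: "?W h r ys = A * ?W f p ys - B * ?W g q ys"
    if ys: "length ys = Suc k" and nodes: "\<And>x j. (x, j) \<in> set (confluent_nodes ys) \<Longrightarrow>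
      j < k \<and> x \<in> {a..b} \<or> j = k \<and> x \<in> {a<..<b}" for ys
  proof -
    define row where "row h r j = (if j < m then vec_index r j
      else case confluent_nodes ys ! (j - m) of (\<xi>, i) \<Rightarrow> nth_deriv_within {a..b} i h \<xi>)"
      for h and r :: "real Matrix.vec" and j
    obtain c where c: "\<And>h r. ?W h r ys = (\<Sum>j<Suc (m + k). row h r j * c j)"
      using W_det_linear_in_last_row[OF assms(6,3) ys, of "{a..b}"]
      unfolding row_def by blast
    have row_lin: "row h r j = A * row f p j - B * row g q j" if "j < Suc (m + k)" for j
    proof (cases "j < m")
      case False
      then have "confluent_nodes ys ! (j - m) \<in> set (confluent_nodes ys)"
        using that ys by (intro nth_mem) (simp add: length_confluent_nodes)
      then show ?thesis using False nodes Dh by (auto simp: row_def split: prod.splits)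
    qed (simp add: r_def row_def)
    have "?W h r ys = (\<Sum>j<Suc (m + k). A * (row f p j * c j) - B * (row g q j * c j))"
      unfolding c by (intro sum.cong refl) (simp add: row_lin left_diff_distrib)
    then show ?thesis unfolding c sum_subtractf sum_distrib_left .
  qed
  have ne: "set xs \<noteq> {}" using asm by auto
  have lr: "Min (set xs) \<in> {a..b}" "Max (set xs) \<in> {a..b}"
    using asm Min_in[OF finite_set ne] Max_in[OF finite_set ne] by blast+
  have "?W h r xs = A * ?W f p xs - B * ?W g q xs"
  proof (rule lin)
    fix x j assume xj: "(x, j) \<in> set (confluent_nodes xs)"
    then show "j < k \<and> x \<in> {a..b} \<or> j = k \<and> x \<in> {a<..<b}"
      using confluent_nodes_order_less[of xs x j] asm by (auto simp: set_confluent_nodes)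
  qed (use asm in simp)
  then have "?W h r xs = 0" by (simp add: A_def B_def)
  then obtain \<xi> where xi: "Min (set xs) < \<xi>" "\<xi> < Max (set xs)"
    "?W h r (replicate (Suc k) \<xi>) = 0"
    using W_det_rolle[OF assms(1,2,3,6,5,7,8) _ _ _ h, of xs r] asm by auto
  have "?W h r (replicate (Suc k) \<xi>) =
      A * ?W f p (replicate (Suc k) \<xi>) - B * ?W g q (replicate (Suc k) \<xi>)"
    by (rule lin) (use xi lr in \<open>auto simp: set_confluent_nodes_replicate simp del: replicate.simps\<close>)
  then have "?W f p (replicate (k + 1) \<xi>) * A = ?W g q (replicate (k + 1) \<xi>) * B"
    using xi(3) by (simp add: mult.commute del: replicate.simps)
  then show "\<exists>\<xi>. Min (set xs) < \<xi> \<and> \<xi> < Max (set xs) \<and>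
      ?W f p (replicate (k + 1) \<xi>) * ?W g q xs = ?W g q (replicate (k + 1) \<xi>) * ?W f p xs"
    using xi(1,2) unfolding A_def B_def by blast
qed

end
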